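(* Let $(\pi^n)_{n\in\mathbb{N}}$ be a sequence of partitions and let $S\in\mathcal{L}_c(\pi^n)$, i.e. $S\in C([0,\infty),\mathbb{R})$ has a continuous local time $L_t(u)=L_t(S,u)$ along $(\pi^n)$. Let $f\colon\mathbb{R}\to\mathbb{R}$ be absolutely continuous with right-continuous Radon-Nikodym derivative $f'$ of locally bounded variation. Then for all $t\in[0,\infty)$ the generalized change of variable formula $$f(S(t))=f(S(0))+\int_0^t f'(S(s))\,\mathrm{d}S(s)+\int_{-\infty}^{\infty}L_t(u)\,\mathrm{d}f'(u)$$ holds, where $$\int_0^t f'(S(s))\,\mathrm{d}S(s):=\lim_{n\to\infty}\sum_{t_j\in\pi^n}f'(S(t_j))\,\bigl(S(t_{j+1}\wedge t)-S(t_j\wedge t)\bigr),\qquad t\in[0,\infty)$$ (in particular this limit exists). In particular, the integral $\int_0^{\cdot}g(S(s))\,\mathrm{d}S(s)$, defined as the limit of the same Riemann sums with $g$ in place of $f'$, is defined for all $g\colon\mathbb{R}\to\mathbb{R}$ of locally bounded variation, and for all $T>0$ the map $\mathrm{BV}\ni g\mapsto\int_0^{\cdot}g(S(s))\,\mathrm{d}S(s)\in C([0,T],\mathbb{R})$ defines a bounded linear operator.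
   Context: Partitions: a partition $\pi$ is an increasing sequence $0=t_0<t_1<\dots$ without accumulation points in $[0,\infty)$, possibly taking the value $\infty$ (in which case it stops there). In sums over $t_j\in\pi$, $t_j$ ranges over the finite elements and $t_{j+1}$ is the successor of $t_j$ in $\pi$ (possibly $\infty$); for fixed $t$ only finitely many terms are nonzero. For $T>0$ put $\pi[0,T]:=\{t_j: t_j\in[0,T)\}\cup\{T\}$, and for continuous $S\colon[0,\infty)\to\mathbb{R}$ let $m(S,\pi[0,T])$ be the maximum of $|S(s_j)-S(s_{j-1})|$ over consecutive elements $s_{j-1}<s_j$ of $\pi[0,T]$. Discrete local time: for real $a,b$ let $J(a,b):=(a,b]$ if $a\le b$ and $J(a,b):=(b,a]$ if $a>b$. For a partition $\pi$, $t\ge0$, $u\in\mathbb{R}$, $$L^{\pi}_t(S,u):=\sum_{t_j\in\pi}\mathbf{1}_{J(S(t_j\wedge t),\,S(t_{j+1}\wedge t))}(u)\,|S(t_{j+1}\wedge t)-u|.$$ $L^2$-local time: a function $L(S)\colon[0,\infty)\times\mathbb{R}\to\mathbb{R}$ is an $L^2$-local time of $S\in C([0,\infty),\mathbb{R})$ along $(\pi^n)$ if for all $t\in[0,\infty)$ one has $\lim_{n\to\infty}m(S,\pi^n[0,t])=0$ and $L^{\pi^n}_t(S,\cdot)$ converges weakly in $L^2(\mathrm{d}u)$ to $L_t(S,\cdot)$. $\mathcal{L}_{L^2}(\pi^n)$ is the set of continuous functions having an $L^2$-local time along $(\pi^n)$. Continuous local time: $S\in\mathcal{L}_{L^2}(\pi^n)$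 has a continuous local time along $(\pi^n)$ if for all $t\in[0,\infty)$ the functions $L^{\pi^n}_t(S,\cdot)$ converge uniformly on $\mathbb{R}$ to a continuous limit $L_t(S,\cdot)$ as $n\to\infty$ and $(t,u)\mapsto L_t(S,u)$ is jointly continuous. $\mathcal{L}_c(\pi^n)$ is the set of all such $S$; one writes $L_t(u)=L_t(S,u)$. $\mathrm{BV}$ is the space of right-continuous functions $g\colon\mathbb{R}\to\mathbb{R}$ of bounded variation, equipped with the total variation norm, understood as $|g(-\infty)|$ plus the total variation of $g$ on $\mathbb{R}$, where $g(-\infty)=\lim_{x\to-\infty}g(x)$. $C([0,T],\mathbb{R})$ carries the supremum norm. The integral $\int L_t(u)\,\mathrm{d}f'(u)$ is the Lebesgue-Stieltjes integral of the compactly supported continuous function $L_t$ against the signed Radon measure determined by $f'$, which assigns mass $f'(b)-f'(a)$ to $(a,b]$. *)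

theory Defs
  imports "HOL-Analysis.Analysis"
begin

section \<open>Partitions\<close>

text \<open>
  A partition is a sequence \<open>p :: nat \<Rightarrow> ereal\<close> with \<open>p j = t\<^sub>j\<close>. If the partition takes the value
  \<open>\<infinity>\<close> it stops there, which is encoded by padding: all later entries are \<open>\<infinity>\<close> as well.
\<close>

definition finite_points :: "(nat \<Rightarrow> ereal) \<Rightarrow> real set" where
  "finite_points p = {r. ereal r \<in> range p}"

definition is_partition :: "(nat \<Rightarrow> ereal) \<Rightarrow> bool" where
  "is_partition p \<longleftrightarrow>
     p 0 = 0 \<and>
     (\<forall>j. p j < \<infinity> \<longrightarrow> p j < p (Suc j)) \<and>
     (\<forall>j. p j = \<infinity> \<longrightarrow> p (Suc j) = \<infinity>) \<and>
     (\<forall>x\<ge>0. \<not> x islimpt finite_points p)"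

text \<open>The indices \<open>j\<close> over which \<open>t\<^sub>j\<close> ranges in sums over \<open>t\<^sub>j \<in> \<pi>\<close>, and the time \<open>t\<^sub>j \<and> t\<close>.\<close>

definition finite_indices :: "(nat \<Rightarrow> ereal) \<Rightarrow> nat set" where
  "finite_indices p = {j. p j < \<infinity>}"

definition stopped :: "(nat \<Rightarrow> ereal) \<Rightarrow> real \<Rightarrow> nat \<Rightarrow> real" where
  "stopped p t j = real_of_ereal (min (p j) (ereal t))"

definition restrict_partition :: "(nat \<Rightarrow> ereal) \<Rightarrow> real \<Rightarrow> real set" where
  "restrict_partition p T = (finite_points p \<inter> {0..<T}) \<union> {T}"

text \<open>
  Inserting \<open>0\<close> only matters when there are no two consecutive elements, that is for \<open>T = 0\<close>,
  where the maximum would range over the empty set.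
\<close>

definition max_increment :: "(real \<Rightarrow> real) \<Rightarrow> (nat \<Rightarrow> ereal) \<Rightarrow> real \<Rightarrow> real" where
  "max_increment S p T =
     Max (insert 0 {\<bar>S s' - S s\<bar> | s s'.
       s \<in> restrict_partition p T \<and> s' \<in> restrict_partition p T \<and> s < s' \<and>
       restrict_partition p T \<inter> {s<..<s'} = {}})"


section \<open>Local times\<close>

definition J_interval :: "real \<Rightarrow> real \<Rightarrow> real set" where
  "J_interval a b = (if a \<le> b then {a<..b} else {b<..a})"

definition discrete_local_time :: "(nat \<Rightarrow> ereal) \<Rightarrow> (real \<Rightarrow> real) \<Rightarrow> real \<Rightarrow> real \<Rightarrow> real" where
  "discrete_local_time p S t u =
     (\<Sum>\<^sub>\<infinity>j\<in>finite_indices p.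
        indicator (J_interval (S (stopped p t j)) (S (stopped p t (Suc j)))) u *
        \<bar>S (stopped p t (Suc j)) - u\<bar>)"

definition in_L2 :: "(real \<Rightarrow> real) \<Rightarrow> bool" where
  "in_L2 h \<longleftrightarrow> h \<in> borel_measurable lebesgue \<and> integrable lebesgue (\<lambda>u. (h u)\<^sup>2)"

text \<open>Weak convergence, with the dual of \<open>L\<^sup>2\<close> identified with \<open>L\<^sup>2\<close>.\<close>

definition weakly_converges_L2 :: "(nat \<Rightarrow> real \<Rightarrow> real) \<Rightarrow> (real \<Rightarrow> real) \<Rightarrow> bool" where
  "weakly_converges_L2 F l \<longleftrightarrow>
     (\<forall>n. in_L2 (F n)) \<and> in_L2 l \<and>
     (\<forall>h. in_L2 h \<longrightarrow>
        (\<lambda>n. LINT u|lebesgue. F n u * h u) \<longlonglongrightarrow> (LINT u|lebesgue. l u * h u))"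

text \<open>
  A path \<open>S \<in> C([0,\<infinity>))\<close> is a function on \<open>\<real>\<close> of which only the values on \<open>[0,\<infinity>)\<close> are used;
  likewise \<open>L t\<close> is only used for \<open>t \<ge> 0\<close>.
\<close>

definition is_L2_local_time ::
  "(nat \<Rightarrow> nat \<Rightarrow> ereal) \<Rightarrow> (real \<Rightarrow> real) \<Rightarrow> (real \<Rightarrow> real \<Rightarrow> real) \<Rightarrow> bool" where
  "is_L2_local_time \<pi> S L \<longleftrightarrow>
     (\<forall>t\<ge>0. (\<lambda>n. max_increment S (\<pi> n) t) \<longlonglongrightarrow> 0 \<and>
             weakly_converges_L2 (\<lambda>n. discrete_local_time (\<pi> n) S t) (L t))"

definition paths_with_L2_local_time :: "(nat \<Rightarrow> nat \<Rightarrow> ereal) \<Rightarrow> (real \<Rightarrow> real) set" where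
  "paths_with_L2_local_time \<pi> = {S. continuous_on {0..} S \<and> (\<exists>L. is_L2_local_time \<pi> S L)}"

text \<open>
  \<open>S\<close> has a continuous local time along \<open>\<pi>\<close> iff \<open>is_continuous_local_time \<pi> S L\<close> for some \<open>L\<close>,
  and then \<open>L t\<close> is uniquely determined for every \<open>t \<ge> 0\<close>.
\<close>

definition is_continuous_local_time ::
  "(nat \<Rightarrow> nat \<Rightarrow> ereal) \<Rightarrow> (real \<Rightarrow> real) \<Rightarrow> (real \<Rightarrow> real \<Rightarrow> real) \<Rightarrow> bool" where
  "is_continuous_local_time \<pi> S L \<longleftrightarrow>
     S \<in> paths_with_L2_local_time \<pi> \<and>
     (\<forall>t\<ge>0. uniform_limit UNIV (\<lambda>n. discrete_local_time (\<pi> n) S t) (L t) sequentially \<and>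
             continuous_on UNIV (L t)) \<and>
     continuous_on ({0..} \<times> UNIV) (\<lambda>(t, u). L t u)"


section \<open>Functions of bounded variation and absolutely continuous functions\<close>

definition variation_sums :: "(real \<Rightarrow> real) \<Rightarrow> real set \<Rightarrow> real set" where
  "variation_sums g A =
     {(\<Sum>i<n. \<bar>g (x (Suc i)) - g (x i)\<bar>) | n x.
        (\<forall>i\<le>n. x i \<in> A) \<and> (\<forall>i<n. x i \<le> x (Suc i))}"

definition bounded_variation_on :: "(real \<Rightarrow> real) \<Rightarrow> real set \<Rightarrow> bool" where
  "bounded_variation_on g A \<longleftrightarrow> bdd_above (variation_sums g A)"

definition total_variation :: "(real \<Rightarrow> real) \<Rightarrow> real set \<Rightarrow> real" where
  "total_variation g A = Sup (variation_sums g A)"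

definition locally_bounded_variation :: "(real \<Rightarrow> real) \<Rightarrow> bool" where
  "locally_bounded_variation g \<longleftrightarrow> (\<forall>a b. bounded_variation_on g {a..b})"

definition right_continuous :: "(real \<Rightarrow> real) \<Rightarrow> bool" where
  "right_continuous g \<longleftrightarrow> (\<forall>x. continuous (at_right x) g)"

definition BV :: "(real \<Rightarrow> real) set" where
  "BV = {g. right_continuous g \<and> bounded_variation_on g UNIV}"

definition BV_norm :: "(real \<Rightarrow> real) \<Rightarrow> real" where
  "BV_norm g = \<bar>Lim at_bot g\<bar> + total_variation g UNIV"

text \<open>
  Absolute continuity on \<open>\<real>\<close> means absolute continuity on every compact interval. The elements of
  \<open>\<D>\<close> are non-overlapping compact intervals \<open>K = {Inf K..Sup K}\<close>.
\<close>

definition absolutely_continuous_fun :: "(real \<Rightarrow> real) \<Rightarrow> bool" where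
  "absolutely_continuous_fun f \<longleftrightarrow>
     (\<forall>a b. \<forall>\<epsilon>>0. \<exists>\<delta>>0. \<forall>\<D> A.
        \<D> division_of A \<and> A \<subseteq> {a..b} \<and> (\<Sum>K\<in>\<D>. Sup K - Inf K) < \<delta> \<longrightarrow>
        (\<Sum>K\<in>\<D>. \<bar>f (Sup K) - f (Inf K)\<bar>) < \<epsilon>)"

definition has_RN_derivative :: "(real \<Rightarrow> real) \<Rightarrow> (real \<Rightarrow> real) \<Rightarrow> bool" where
  "has_RN_derivative f f' \<longleftrightarrow>
     (\<forall>a b. a \<le> b \<longrightarrow>
        set_integrable lborel {a..b} f' \<and> f b - f a = (LINT u:{a..b}|lborel. f' u))"


section \<open>The Lebesgue-Stieltjes integral\<close>

text \<open>
  Jordan decomposition: for right-continuous \<open>g\<close> of locally bounded variation, the functions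
  \<open>pos_variation g\<close> and \<open>neg_variation g\<close> are nondecreasing and right-continuous with difference
  \<open>g\<close>. Hence they generate Radon measures whose difference is the signed Radon measure giving mass
  \<open>g b - g a\<close> to \<open>{a<..b}\<close>.
\<close>

definition variation_function :: "(real \<Rightarrow> real) \<Rightarrow> real \<Rightarrow> real" where
  "variation_function g x =
     (if 0 \<le> x then total_variation g {0..x} else - total_variation g {x..0})"

definition pos_variation :: "(real \<Rightarrow> real) \<Rightarrow> real \<Rightarrow> real" where
  "pos_variation g x = (variation_function g x + g x) / 2"

definition neg_variation :: "(real \<Rightarrow> real) \<Rightarrow> real \<Rightarrow> real" where
  "neg_variation g x = (variation_function g x - g x) / 2"

definition LS_integrable :: "(real \<Rightarrow> real) \<Rightarrow> (real \<Rightarrow> real) \<Rightarrow> bool" where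
  "LS_integrable h g \<longleftrightarrow>
     integrable (interval_measure (pos_variation g)) h \<and>
     integrable (interval_measure (neg_variation g)) h"

definition LS_integral :: "(real \<Rightarrow> real) \<Rightarrow> (real \<Rightarrow> real) \<Rightarrow> real" where
  "LS_integral h g =
     (LINT u|interval_measure (pos_variation g). h u) -
     (LINT u|interval_measure (neg_variation g). h u)"


section \<open>The pathwise integral\<close>

definition riemann_sum ::
  "(nat \<Rightarrow> ereal) \<Rightarrow> (real \<Rightarrow> real) \<Rightarrow> (real \<Rightarrow> real) \<Rightarrow> real \<Rightarrow> real" where
  "riemann_sum p g S t =
     (\<Sum>\<^sub>\<infinity>j\<in>finite_indices p.
        g (S (real_of_ereal (p j))) * (S (stopped p t (Suc j)) - S (stopped p t j)))"

definition pathwise_integrable ::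
  "(nat \<Rightarrow> nat \<Rightarrow> ereal) \<Rightarrow> (real \<Rightarrow> real) \<Rightarrow> (real \<Rightarrow> real) \<Rightarrow> real \<Rightarrow> bool" where
  "pathwise_integrable \<pi> g S t \<longleftrightarrow> convergent (\<lambda>n. riemann_sum (\<pi> n) g S t)"

definition pathwise_integral ::
  "(nat \<Rightarrow> nat \<Rightarrow> ereal) \<Rightarrow> (real \<Rightarrow> real) \<Rightarrow> (real \<Rightarrow> real) \<Rightarrow> real \<Rightarrow> real" where
  "pathwise_integral \<pi> g S t = lim (\<lambda>n. riemann_sum (\<pi> n) g S t)"

text \<open>
  \<open>\<Phi>\<close> is a bounded linear operator from \<open>BV\<close> to \<open>C([0,T],\<real>)\<close> with the supremum norm; both spaces
  are given by carriers, and elements of \<open>C([0,T],\<real>)\<close> by their values on \<open>{0..T}\<close>.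
\<close>

definition bounded_linear_BV_C :: "real \<Rightarrow> ((real \<Rightarrow> real) \<Rightarrow> real \<Rightarrow> real) \<Rightarrow> bool" where
  "bounded_linear_BV_C T \<Phi> \<longleftrightarrow>
     (\<forall>g\<in>BV. continuous_on {0..T} (\<Phi> g)) \<and>
     (\<forall>g\<in>BV. \<forall>h\<in>BV. \<forall>t\<in>{0..T}. \<Phi> (\<lambda>x. g x + h x) t = \<Phi> g t + \<Phi> h t) \<and>
     (\<forall>c. \<forall>g\<in>BV. \<forall>t\<in>{0..T}. \<Phi> (\<lambda>x. c * g x) t = c * \<Phi> g t) \<and>
     (\<exists>K. \<forall>g\<in>BV. (SUP t\<in>{0..T}. \<bar>\<Phi> g t\<bar>) \<le> K * BV_norm g)"

end

theory Submission
  imports Defs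
begin

text \<open>
  Along a single partition stopped at \<open>t\<close>, only the finitely many sampled values
  \<open>S 0 = y 0, y 1, \<dots>, y N = S t\<close> matter. For the indicator \<open>g\<close> of a half-line \<open>[c, \<infinity>)\<close> a check of
  cases for each step gives the discrete Tanaka formula
  \<open>(S t - c)\<^sup>+ - (S 0 - c)\<^sup>+ = \<Sum> g (y j) (y (j + 1) - y j) + L\<^sup>\<pi> c\<close> (\<open>path_sum_halfline\<close>).

  A Riemann sum of an arbitrary \<open>g\<close> sees \<open>g\<close> only at the points \<open>y j\<close>. Therefore \<open>g\<close> may be replaced
  by a step function that jumps only on a finite grid \<open>x 0 \<le> \<dots> \<le> x M\<close> containing these points, that
  is by a combination of half-line indicators with coefficients \<open>g (x (i + 1)) - g (x i)\<close>. Summing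
  Tanaka's formula (\<open>path_sum_on_grid\<close>) expresses the Riemann sum through the increment of a
  primitive of the step function and the finite Stieltjes sum
  \<open>\<Sum> (g (x (i + 1)) - g (x i)) L\<^sup>\<pi> (x (i + 1))\<close>. The grid may be refined at will, and it may be
  chosen to serve two partitions and two times simultaneously. Everything follows from this:

  \<^item> For two partitions and two times the Riemann sums differ at most by
    \<open>sup \<bar>g\<bar> \<cdot> \<bar>S t - S s\<bar>\<close> plus the variation of \<open>g\<close> on the range of \<open>S\<close> times the uniform distance of
    the discrete local times (\<open>riemann_sum_diff_le\<close>). With \<open>s = t\<close> this makes the Riemann sums a
    Cauchy sequence for every \<open>g\<close> of locally bounded variation, whatever its values at its jumps.
    In the limit it becomes a modulus of continuity in \<open>t\<close> and, with \<open>s = 0\<close>, the bound on the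
    operator norm.

  \<^item> If \<open>g\<close> is right-continuous and the mesh of the grid tends to \<open>0\<close>, the primitive of the step
    function approximates \<open>f\<close>, and the Stieltjes sum, with the discrete local time replaced by the
    uniformly close continuous \<open>L t\<close>, approximates the Lebesgue-Stieltjes integral of \<open>L t\<close>
    (\<open>change_of_variable_error\<close>). This is the change of variable formula.

  In all estimates the variation of \<open>g\<close> enters through the variation function \<open>v\<close>, by way of
  \<open>\<bar>g b - g a\<bar> \<le> v b - v a\<close> for \<open>a \<le> b\<close>: such bounds telescope along a grid. The measures of the
  Jordan decomposition can be evaluated because \<open>v\<close> is right-continuous whenever \<open>g\<close> is
  (\<open>right_continuous_variation_function\<close>).
\<close>

section \<open>The variation function\<close>

lemma variation_sum_le_total_variation:
  assumes "bounded_variation_on g A" "\<And>i. i \<le> n \<Longrightarrow> x i \<in> A" "\<And>i. i < n \<Longrightarrow> x i \<le> x (Suc i)"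
  shows "(\<Sum>i<n. \<bar>g (x (Suc i)) - g (x i)\<bar>) \<le> total_variation g A"
  unfolding total_variation_def using assms
  by (intro cSup_upper) (auto simp: variation_sums_def bounded_variation_on_def)

lemma variation_sums_nonempty: "A \<noteq> {} \<Longrightarrow> variation_sums g A \<noteq> {}"
proof -
  assume "A \<noteq> {}"
  then obtain a where "a \<in> A" by blast
  then have "0 \<in> variation_sums g A"
    unfolding variation_sums_def by (intro CollectI exI[of _ 0] exI[of _ "\<lambda>_. a"]) simp
  then show ?thesis by blast
qed

lemma abs_diff_le_total_variation:
  assumes "bounded_variation_on g A" "a \<in> A" "b \<in> A" "a \<le> b"
  shows "\<bar>g b - g a\<bar> \<le> total_variation g A"
  using variation_sum_le_total_variation[of g A 1 "\<lambda>i. if i = 0 then a else b"] assms by auto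

lemma total_variation_mono:
  assumes "bounded_variation_on g B" "A \<subseteq> B" "A \<noteq> {}"
  shows "bounded_variation_on g A" "total_variation g A \<le> total_variation g B"
proof -
  have sub: "variation_sums g A \<subseteq> variation_sums g B"
    unfolding variation_sums_def using assms(2) by blast
  show "bounded_variation_on g A"
    using assms(1) sub unfolding bounded_variation_on_def by (rule bdd_above_mono)
  show "total_variation g A \<le> total_variation g B"
    unfolding total_variation_def
    using cSup_subset_mono[OF variation_sums_nonempty[OF assms(3)] _ sub] assms(1)
    unfolding bounded_variation_on_def by blast
qed

text \<open>
  The bound telescopes along every subdivision. Together with \<open>abs_diff_le_total_variation\<close> this
  says that the variation has the smallest increments among all functions that majorize the
  increments of \<open>g\<close>.
\<close>

lemma total_variation_le_majorant:
  assumes "a \<le> b"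
    and major: "\<And>p q. a \<le> p \<Longrightarrow> p \<le> q \<Longrightarrow> q \<le> b \<Longrightarrow> \<bar>g q - g p\<bar> \<le> w q - w p"
  shows "total_variation g {a..b} \<le> w b - w a"
proof -
  have "s \<le> w b - w a" if s: "s \<in> variation_sums g {a..b}" for s
  proof -
    obtain n x where x: "\<And>i. i \<le> n \<Longrightarrow> x i \<in> {a..b}" "\<And>i. i < n \<Longrightarrow> x i \<le> x (Suc i)"
      and "s = (\<Sum>i<n. \<bar>g (x (Suc i)) - g (x i)\<bar>)"
      using s unfolding variation_sums_def by blast
    then have "s \<le> (\<Sum>i<n. w (x (Suc i)) - w (x i))"
      by (auto intro!: sum_mono major simp: Suc_le_eq)
    also have "\<dots> = w (x n) - w (x 0)"
      by (rule sum_lessThan_telescope)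
    also have "\<dots> \<le> w b - w a"
      using major[of a "x 0"] major[of "x n" b] x(1)[of 0] x(1)[of n] by auto
    finally show ?thesis .
  qed
  then show ?thesis
    unfolding total_variation_def using assms(1) by (intro cSup_least variation_sums_nonempty) auto
qed

text \<open>
  Subdivisions of \<open>[a, b]\<close> and \<open>[b, c]\<close> concatenate to one of \<open>[a, c]\<close>; the step that joins them
  only adds to the variation sum.
\<close>

lemma total_variation_superadditive:
  assumes bv: "bounded_variation_on g {a..c}" and "a \<le> b" "b \<le> c"
  shows "total_variation g {a..b} + total_variation g {b..c} \<le> total_variation g {a..c}"
proof -
  have concat: "s + s' \<le> total_variation g {a..c}"
    if s: "s \<in> variation_sums g {a..b}" and s': "s' \<in> variation_sums g {b..c}" for s s'
  proof -
    obtain n x where x: "\<And>i. i \<le> n \<Longrightarrow> x i \<in> {a..b}" "\<And>i. i < n \<Longrightarrow> x i \<le> x (Suc i)"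
      and seq: "s = (\<Sum>i<n. \<bar>g (x (Suc i)) - g (x i)\<bar>)"
      using s unfolding variation_sums_def by blast
    obtain m y where y: "\<And>i. i \<le> m \<Longrightarrow> y i \<in> {b..c}" "\<And>i. i < m \<Longrightarrow> y i \<le> y (Suc i)"
      and seq': "s' = (\<Sum>i<m. \<bar>g (y (Suc i)) - g (y i)\<bar>)"
      using s' unfolding variation_sums_def by blast
    define z where "z = (\<lambda>i. if i \<le> n then x i else y (i - Suc n))"
    have "(\<Sum>i<Suc n + m. \<bar>g (z (Suc i)) - g (z i)\<bar>) =
        (\<Sum>i<Suc n. \<bar>g (z (Suc i)) - g (z i)\<bar>) + (\<Sum>i<m. \<bar>g (z (Suc (Suc n + i))) - g (z (Suc n + i))\<bar>)"
      by (simp only: lessThan_atLeast0 sum.atLeastLessThan_concat[of 0 "Suc n" "Suc n + m", symmetric]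
            sum.shift_bounds_nat_ivl sum.atLeastLessThan_shift_0[of _ "Suc n" "Suc n + m"])
        (simp add: add.commute sum.atLeastLessThan_shift_0[of _ "Suc n" "Suc n + m"])
    also have "\<dots> = s + \<bar>g (y 0) - g (x n)\<bar> + s'"
      by (simp add: seq seq' z_def)
    finally have "s + s' \<le> (\<Sum>i<Suc n + m. \<bar>g (z (Suc i)) - g (z i)\<bar>)" by linarith
    also have "\<dots> \<le> total_variation g {a..c}"
    proof (rule variation_sum_le_total_variation[OF bv])
      show "z i \<in> {a..c}" if "i \<le> Suc n + m" for i
        using x(1)[of i] y(1)[of "i - Suc n"] that assms(2,3) by (force simp: z_def)
      show "z i \<le> z (Suc i)" if i: "i < Suc n + m" for i
      proof -
        consider "i < n" | "i = n" | "i > n" by linarith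
        then show ?thesis
        proof cases
          case 1 then show ?thesis using x(2) by (simp add: z_def)
        next
          case 2 then show ?thesis using x(1)[of n] y(1)[of 0] by (simp add: z_def)
        next
          case 3
          then have "Suc i - Suc n = Suc (i - Suc n)" "i - Suc n < m" using i by auto
          then show ?thesis using y(2)[of "i - Suc n"] 3 by (simp add: z_def)
        qed
      qed
    qed
    finally show ?thesis .
  qed
  have ne: "variation_sums g {a..b} \<noteq> {}" "variation_sums g {b..c} \<noteq> {}"
    using assms(2,3) by (simp_all add: variation_sums_nonempty)
  have "total_variation g {a..b} \<le> total_variation g {a..c} - s'"
    if "s' \<in> variation_sums g {b..c}" for s'
    unfolding total_variation_def[of g "{a..b}"]
  proof (rule cSup_least[OF ne(1)])
    show "s \<le> total_variation g {a..c} - s'" if "s \<in> variation_sums g {a..b}" for s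
      using concat[of s s'] that \<open>s' \<in> _\<close> by linarith
  qed
  then have "total_variation g {b..c} \<le> total_variation g {a..c} - total_variation g {a..b}"
    unfolding total_variation_def[of g "{b..c}"] by (intro cSup_least[OF ne(2)]) force
  then show ?thesis by linarith
qed

lemma total_variation_point [simp]: "total_variation g {a} = 0"
proof -
  have bd: "bounded_variation_on g {a}"
    unfolding bounded_variation_on_def
  proof (rule bdd_aboveI)
    fix s assume "s \<in> variation_sums g {a}"
    then obtain n x where x: "\<And>i. i \<le> n \<Longrightarrow> x i = a"
      and "s = (\<Sum>i<n. \<bar>g (x (Suc i)) - g (x i)\<bar>)"
      unfolding variation_sums_def by auto
    then show "s \<le> 0" by (simp add: Suc_le_eq)
  qed
  show ?thesis
    using total_variation_le_majorant[of a a g "\<lambda>_. 0"] abs_diff_le_total_variation[OF bd, of a a]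
    by (auto simp: order_antisym_conv)
qed

text \<open>
  For the upper bound no common refinement of subdivisions is needed: by superadditivity, the
  variation over \<open>[a, x]\<close> computed by splitting at \<open>b\<close> majorizes the increments of \<open>g\<close>, and
  \<open>total_variation_le_majorant\<close> applies to it.
\<close>

lemma total_variation_additive:
  assumes bv: "bounded_variation_on g {a..c}" and "a \<le> b" "b \<le> c"
  shows "total_variation g {a..c} = total_variation g {a..b} + total_variation g {b..c}"
proof (rule antisym)
  have sub: "bounded_variation_on g {p..q}" if "a \<le> p" "p \<le> q" "q \<le> c" for p q
    using total_variation_mono(1)[OF bv, of "{p..q}"] that by auto
  have step: "total_variation g {r..p} + \<bar>g q - g p\<bar> \<le> total_variation g {r..q}"
    if "a \<le> r" "r \<le> p" "p \<le> q" "q \<le> c" for r p q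
    using total_variation_superadditive[OF sub, of r q p] abs_diff_le_total_variation[OF sub, of p q p q]
      that by auto
  \<comment> \<open>the variation over \<open>[a, x]\<close>, split at \<open>b\<close>\<close>
  define w where "w = (\<lambda>x. if x \<le> b then total_variation g {a..x}
                          else total_variation g {a..b} + total_variation g {b..x})"
  have "\<bar>g q - g p\<bar> \<le> w q - w p" if "a \<le> p" "p \<le> q" "q \<le> c" for p q
  proof -
    consider "q \<le> b" | "b < p" | "p \<le> b" "b < q" by linarith
    then show ?thesis
    proof cases
      case 1 then show ?thesis using step[of a p q] that by (simp add: w_def)
    next
      case 2 then show ?thesis using step[of b p q] that assms by (simp add: w_def)
    next
      case 3
      then show ?thesis
        using step[of a p b] step[of b b q] that assms abs_triangle_ineq[of "g q - g b" "g b - g p"]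
        by (simp add: w_def)
    qed
  qed
  from total_variation_le_majorant[of a c g w, OF _ this]
  have "total_variation g {a..c} \<le> w c - w a" using assms by linarith
  also have "\<dots> \<le> total_variation g {a..b} + total_variation g {b..c}"
    using assms by (auto simp: w_def)
  finally show "total_variation g {a..c} \<le> total_variation g {a..b} + total_variation g {b..c}" .
qed (use assms total_variation_superadditive in blast)

lemma variation_function_diff:
  assumes lbv: "locally_bounded_variation g" and "a \<le> b"
  shows "variation_function g b - variation_function g a = total_variation g {a..b}"
proof -
  have add: "total_variation g {p..r} = total_variation g {p..q} + total_variation g {q..r}"
    if "p \<le> q" "q \<le> r" for p q r
    using total_variation_additive lbv that unfolding locally_bounded_variation_def by blast
  show ?thesis
    using add[of 0 a b] add[of a 0 b] add[of a b 0] assms(2)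
    by (auto simp: variation_function_def not_le)
qed

lemma variation_function_majorant:
  assumes "locally_bounded_variation g" "a \<le> b"
  shows "\<bar>g b - g a\<bar> \<le> variation_function g b - variation_function g a"
  using assms abs_diff_le_total_variation[of g "{a..b}" a b]
  by (simp add: variation_function_diff locally_bounded_variation_def)

lemma mono_variation_function:
  assumes "locally_bounded_variation g"
  shows "mono (variation_function g)"
  using variation_function_majorant[OF assms] by (intro monoI) (smt (verit))

lemma mono_pos_variation: "locally_bounded_variation g \<Longrightarrow> mono (pos_variation g)"
  using variation_function_majorant[of g] by (intro monoI) (smt (verit) pos_variation_def divide_right_mono)

lemma mono_neg_variation: "locally_bounded_variation g \<Longrightarrow> mono (neg_variation g)"
  using variation_function_majorant[of g] by (intro monoI) (smt (verit) neg_variation_def divide_right_mono)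

lemma mono_tendsto_at_right:
  fixes v :: "real \<Rightarrow> real"
  assumes "mono v"
  shows "(v \<longlongrightarrow> Inf (v ` {x<..})) (at_right x)"
proof -
  have bdd: "bdd_below (v ` {x<..})"
    using assms by (intro bdd_belowI[of _ "v x"]) (auto simp: mono_def)
  show ?thesis
  proof (rule decreasing_tendsto)
    show "\<forall>\<^sub>F y in at_right x. Inf (v ` {x<..}) \<le> v y"
      using bdd by (auto simp: eventually_at_right_field intro!: cInf_lower exI[of _ "x + 1"])
    fix c assume "Inf (v ` {x<..}) < c"
    then obtain z where "z > x" "v z < c"
      using cInf_lessD[of "v ` {x<..}" c] by auto
    then show "\<forall>\<^sub>F y in at_right x. v y < c"
      using assms unfolding eventually_at_right_field mono_def
      by (intro exI[of _ z]) (meson le_less_trans less_imp_le)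
  qed
qed

text \<open>
  The right limits \<open>v'\<close> of the variation function \<open>v\<close> still majorize the increments of a
  right-continuous \<open>g\<close>, and \<open>v\<close> has the smallest increments of all such majorants. Hence
  \<open>v' x - v x \<le> v' y - v y\<close> for \<open>x \<le> y\<close>, and the right-hand side vanishes as \<open>y\<close> decreases to \<open>x\<close>.
\<close>

lemma right_continuous_variation_function:
  assumes lbv: "locally_bounded_variation g" and rc: "right_continuous g"
  shows "continuous (at_right x) (variation_function g)"
proof -
  let ?v = "variation_function g"
  define v' where "v' = (\<lambda>x. Inf (?v ` {x<..}))"
  have v': "(?v \<longlongrightarrow> v' x) (at_right x)" for x
    unfolding v'_def by (intro mono_tendsto_at_right mono_variation_function lbv)
  have g: "(g \<longlongrightarrow> g x) (at_right x)" for x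
    using rc by (simp add: right_continuous_def continuous_within)
  have shift: "((\<lambda>h. F (z + h)) \<longlongrightarrow> l) (at_right 0)" if "(F \<longlongrightarrow> l) (at_right z)"
    for F :: "real \<Rightarrow> real" and l z
    using that by (simp add: filterlim_at_right_to_0[of F _ z] add.commute)
  have major: "\<bar>g q - g p\<bar> \<le> v' q - v' p" if "p \<le> q" for p q
  proof (rule tendsto_le[OF trivial_limit_at_right_real])
    show "((\<lambda>h. ?v (q + h) - ?v (p + h)) \<longlongrightarrow> v' q - v' p) (at_right 0)"
      by (intro tendsto_diff shift v')
    show "((\<lambda>h. \<bar>g (q + h) - g (p + h)\<bar>) \<longlongrightarrow> \<bar>g q - g p\<bar>) (at_right 0)"
      by (intro tendsto_rabs tendsto_diff shift g)
    show "\<forall>\<^sub>F h in at_right 0. \<bar>g (q + h) - g (p + h)\<bar> \<le> ?v (q + h) - ?v (p + h)"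
      using that by (intro always_eventually allI variation_function_majorant[OF lbv]) simp
  qed
  have low: "v' y \<le> ?v z" if "y < z" for y z
    unfolding v'_def using that mono_variation_function[OF lbv]
    by (intro cInf_lower bdd_belowI[of _ "?v y"]) (auto simp: mono_def)
  \<comment> \<open>instead of \<open>v' y - v y\<close>, an increment of \<open>v\<close> to the right of \<open>y = x + h\<close>, which also vanishes
      in the limit\<close>
  have gap: "v' x - ?v x \<le> ?v (x + 2 * h) - ?v (x + h)" if "h > 0" for h
    using total_variation_le_majorant[of x "x + h" g v'] major low[of "x + h" "x + 2 * h"] that
      variation_function_diff[OF lbv, of x "x + h"] by auto
  have double: "filterlim (\<lambda>h::real. 2 * h) (at_right 0) (at_right 0)"
    by (rule filterlim_times_pos[where p = 0]) (auto intro: filterlim_ident)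
  have "v' x - ?v x \<le> v' x - v' x"
  proof (rule tendsto_le[OF trivial_limit_at_right_real])
    show "((\<lambda>h. ?v (x + 2 * h) - ?v (x + h)) \<longlongrightarrow> v' x - v' x) (at_right 0)"
      by (intro tendsto_diff shift[OF v'] filterlim_compose[OF shift[OF v'] double])
    show "((\<lambda>h. v' x - ?v x) \<longlongrightarrow> v' x - ?v x) (at_right 0)" by simp
    show "\<forall>\<^sub>F h in at_right 0. v' x - ?v x \<le> ?v (x + 2 * h) - ?v (x + h)"
      using gap by (auto simp: eventually_at_right_field intro: exI[of _ 1])
  qed
  moreover have "?v x \<le> v' x"
    unfolding v'_def using mono_variation_function[OF lbv]
    by (intro cInf_greatest) (auto simp: mono_def)
  ultimately show ?thesis using v'[of x] by (simp add: continuous_within)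
qed

section \<open>The discrete Tanaka formula for sampled paths\<close>

text \<open>
  The Riemann sum and the discrete local time of a stopped path, as functions of its finitely many
  sampled values \<open>y 0, \<dots>, y N\<close>.
\<close>

definition path_sum :: "(real \<Rightarrow> real) \<Rightarrow> (nat \<Rightarrow> real) \<Rightarrow> nat \<Rightarrow> real" where
  "path_sum g y N = (\<Sum>j<N. g (y j) * (y (Suc j) - y j))"

definition path_local_time :: "(nat \<Rightarrow> real) \<Rightarrow> nat \<Rightarrow> real \<Rightarrow> real" where
  "path_local_time y N u =
     (\<Sum>j<N. indicator (J_interval (y j) (y (Suc j))) u * \<bar>y (Suc j) - u\<bar>)"

text \<open>
  Discrete Tanaka formula. It is a sum over the steps of the path, and holds for each step
  separately; the half-open intervals in the local time match the closed half-line \<open>{c..}\<close>.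
\<close>

lemma path_sum_halfline:
  "path_sum (indicator {c..}) y N = max 0 (y N - c) - max 0 (y 0 - c) - path_local_time y N c"
  by (induction N)
    (auto simp: path_sum_def path_local_time_def J_interval_def indicator_def max_def)

lemma path_sum_linear:
  "path_sum (\<lambda>z. a + (\<Sum>i<M. c i * h i z)) y N = a * (y N - y 0) + (\<Sum>i<M. c i * path_sum (h i) y N)"
proof -
  have "path_sum (\<lambda>z. a + (\<Sum>i<M. c i * h i z)) y N =
      (\<Sum>j<N. a * (y (Suc j) - y j)) + (\<Sum>j<N. \<Sum>i<M. c i * (h i (y j) * (y (Suc j) - y j)))"
    unfolding path_sum_def by (simp add: distrib_right sum.distrib sum_distrib_right mult.assoc)
  also have "(\<Sum>j<N. a * (y (Suc j) - y j)) = a * (y N - y 0)"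
    by (simp add: sum_distrib_left[symmetric] sum_lessThan_telescope)
  also have "(\<Sum>j<N. \<Sum>i<M. c i * (h i (y j) * (y (Suc j) - y j))) = (\<Sum>i<M. c i * path_sum (h i) y N)"
    unfolding path_sum_def by (subst sum.swap) (simp add: sum_distrib_left)
  finally show ?thesis .
qed

lemma grid_mono:
  fixes x :: "nat \<Rightarrow> real"
  assumes mono: "\<And>i. i < M \<Longrightarrow> x i \<le> x (Suc i)" and "i \<le> j" "j \<le> M"
  shows "x i \<le> x j"
  using assms(2,3)
proof (induction j rule: dec_induct)
  case (step n)
  then show ?case using mono[of n] by simp
qed simp

text \<open>
  At a grid point \<open>g\<close> agrees with the step function built from its increments. Repeated grid points
  do no harm since the corresponding increment vanishes.
\<close>

lemma step_function_on_grid: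
  fixes x :: "nat \<Rightarrow> real" and g :: "real \<Rightarrow> real"
  assumes mono: "\<And>i. i < M \<Longrightarrow> x i \<le> x (Suc i)" and "k \<le> M"
  shows "g (x k) = g (x 0) + (\<Sum>i<M. (g (x (Suc i)) - g (x i)) * indicator {x (Suc i)..} (x k))"
proof -
  have le: "x i \<le> x j" if "i \<le> j" "j \<le> M" for i j
    using grid_mono[of M x i j] mono that by blast
  have "(\<Sum>i<M. (g (x (Suc i)) - g (x i)) * indicator {x (Suc i)..} (x k)) =
      (\<Sum>i<M. if i < k then g (x (Suc i)) - g (x i) else 0)"
  proof (rule sum.cong[OF refl])
    fix i assume "i \<in> {..<M}"
    then show "(g (x (Suc i)) - g (x i)) * indicator {x (Suc i)..} (x k) =
        (if i < k then g (x (Suc i)) - g (x i) else 0)"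
      using le[of "Suc i" k] le[of k i] mono[of i] assms(2)
      by (cases "i < k"; cases "x (Suc i) = x i") (auto simp: indicator_def)
  qed
  also have "\<dots> = (\<Sum>i<k. g (x (Suc i)) - g (x i))"
    using assms(2) by (intro sum.mono_neutral_cong_right) auto
  also have "\<dots> = g (x k) - g (x 0)"
    by (rule sum_lessThan_telescope)
  finally show ?thesis by simp
qed

text \<open>
  On the grid \<open>g\<close> is a combination of half-line indicators, so this is the same combination of
  instances of \<open>path_sum_halfline\<close>. The function \<open>A\<close> is a primitive of the step function.
\<close>

lemma path_sum_on_grid:
  fixes x y :: "nat \<Rightarrow> real" and g :: "real \<Rightarrow> real"
  assumes mono: "\<And>i. i < M \<Longrightarrow> x i \<le> x (Suc i)"
    and grid: "\<And>j. j \<le> N \<Longrightarrow> y j \<in> x ` {..M}"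
  defines "A \<equiv> \<lambda>z. g (x 0) * z + (\<Sum>i<M. (g (x (Suc i)) - g (x i)) * max 0 (z - x (Suc i)))"
  shows "path_sum g y N =
    A (y N) - A (y 0) - (\<Sum>i<M. (g (x (Suc i)) - g (x i)) * path_local_time y N (x (Suc i)))"
proof -
  have "path_sum g y N =
      path_sum (\<lambda>z. g (x 0) + (\<Sum>i<M. (g (x (Suc i)) - g (x i)) * indicator {x (Suc i)..} z)) y N"
    unfolding path_sum_def
  proof (rule sum.cong[OF refl])
    fix j assume "j \<in> {..<N}"
    then obtain k where "k \<le> M" "y j = x k" using grid[of j] by auto
    then show "g (y j) * (y (Suc j) - y j) = (g (x 0) +
        (\<Sum>i<M. (g (x (Suc i)) - g (x i)) * indicator {x (Suc i)..} (y j))) * (y (Suc j) - y j)"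
      using step_function_on_grid[of M x k g] mono by simp
  qed
  also have "\<dots> = g (x 0) * (y N - y 0) + (\<Sum>i<M. (g (x (Suc i)) - g (x i)) *
      (max 0 (y N - x (Suc i)) - max 0 (y 0 - x (Suc i)) - path_local_time y N (x (Suc i))))"
    by (simp only: path_sum_linear path_sum_halfline)
  also have "\<dots> = A (y N) - A (y 0) -
      (\<Sum>i<M. (g (x (Suc i)) - g (x i)) * path_local_time y N (x (Suc i)))"
    unfolding A_def by (simp add: ring_distribs sum_subtractf sum.distrib)
  finally show ?thesis .
qed

text \<open>
  Apply \<open>path_sum_on_grid\<close> to the path that climbs from \<open>x k\<close> to \<open>x l\<close> through all grid points in
  between. It has no local time at grid points: a grid point in \<open>(x i, x (i + 1)]\<close> is the right end
  point, where the weight \<open>\<bar>x (i + 1) - u\<bar>\<close> vanishes.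
\<close>

lemma step_primitive_diff:
  fixes x :: "nat \<Rightarrow> real" and g :: "real \<Rightarrow> real"
  assumes mono: "\<And>i. i < M \<Longrightarrow> x i \<le> x (Suc i)" and kl: "k \<le> l" "l \<le> M"
  defines "A \<equiv> \<lambda>z. g (x 0) * z + (\<Sum>i<M. (g (x (Suc i)) - g (x i)) * max 0 (z - x (Suc i)))"
  shows "A (x l) - A (x k) = (\<Sum>i=k..<l. g (x i) * (x (Suc i) - x i))"
proof -
  have le: "x i \<le> x j" if "i \<le> j" "j \<le> M" for i j
    using grid_mono[of M x i j] mono that by blast
  let ?y = "\<lambda>j. x (k + j)"
  have zero: "path_local_time ?y (l - k) (x (Suc i)) = 0" if i: "i < M" for i
    unfolding path_local_time_def
  proof (rule sum.neutral, safe)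
    fix j assume "j < l - k"
    then have "k + j < l" by simp
    then show "indicator (J_interval (x (k + j)) (x (k + Suc j))) (x (Suc i)) *
        \<bar>x (k + Suc j) - x (Suc i)\<bar> = 0"
      using le[of "k + j" "k + Suc j"] le[of "Suc i" "k + j"] le[of "k + Suc j" "Suc i"] i kl
      by (cases "Suc i \<le> k + j") (auto simp: J_interval_def indicator_def)
  qed
  have "(\<Sum>i=k..<l. g (x i) * (x (Suc i) - x i)) = path_sum g ?y (l - k)"
    unfolding path_sum_def lessThan_atLeast0
    using sum.atLeastLessThan_shift_0[of "\<lambda>i. g (x i) * (x (Suc i) - x i)" k l]
    by (simp add: add.commute)
  also have "\<dots> = A (x l) - A (x k)"
    unfolding A_def using kl
    by (subst path_sum_on_grid[where M = M and x = x]) (auto simp: mono zero)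
  finally show ?thesis by simp
qed

text \<open>
  Sort the union of \<open>Y\<close>, the end points and an arithmetic progression of step \<open>\<delta>\<close>: a gap longer than
  \<open>\<delta>\<close> between neighbours would contain a further point of the progression.
\<close>

lemma fine_grid_exists:
  fixes Y :: "real set"
  assumes fin: "finite Y" and Y: "Y \<subseteq> {lo..hi}" and "lo \<le> hi" and "\<delta> > 0"
  obtains x :: "nat \<Rightarrow> real" and M where "x 0 = lo" "x M = hi"
    "\<And>i. i < M \<Longrightarrow> x i \<le> x (Suc i)" "\<And>i. i < M \<Longrightarrow> x (Suc i) - x i \<le> \<delta>" "Y \<subseteq> x ` {..M}"
proof -
  define K where "K = nat \<lceil>(hi - lo) / \<delta>\<rceil>"
  define U where "U = Y \<union> {lo, hi} \<union> ((\<lambda>k. lo + real k * \<delta>) ` {..K} \<inter> {lo..hi})"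
  have finU: "finite U" using fin by (auto simp: U_def)
  have Usub: "U \<subseteq> {lo..hi}" using Y assms(3) by (auto simp: U_def)
  define l where "l = sorted_list_of_set U"
  have l: "sorted l" "set l = U" "distinct l" using finU by (auto simp: l_def)
  define M where "M = length l - 1"
  have "lo \<in> U" "hi \<in> U" by (auto simp: U_def)
  then have "l \<noteq> []" using l(2) by force
  then have len: "length l = Suc M" by (cases l) (auto simp: M_def)
  have mono: "l ! i \<le> l ! j" if "i \<le> j" "j \<le> M" for i j
    using sorted_nth_mono[OF l(1)] that len by simp
  have mem: "l ! i \<in> {lo..hi}" if "i \<le> M" for i
    using that len l(2) Usub nth_mem[of i l] by auto
  have index: "\<exists>i\<le>M. u = l ! i" if "u \<in> U" for u
    using that unfolding l(2)[symmetric] in_set_conv_nth len by (auto simp: less_Suc_eq_le)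
  show thesis
  proof (rule that[of "\<lambda>i. l ! i" M])
    show "l ! 0 = lo" using index[OF \<open>lo \<in> U\<close>] mono[of 0] mem[of 0] by force
    show "l ! M = hi" using index[OF \<open>hi \<in> U\<close>] mono[of _ M] mem[of M] by force
    show "l ! i \<le> l ! Suc i" if "i < M" for i using mono that by simp
    show "Y \<subseteq> (!) l ` {..M}" using index by (auto simp: U_def)
    show "l ! Suc i - l ! i \<le> \<delta>" if i: "i < M" for i
    proof (rule ccontr)
      assume gap: "\<not> l ! Suc i - l ! i \<le> \<delta>"
      \<comment> \<open>the first point \<open>lo + k \<delta>\<close> of the progression that exceeds \<open>l ! i\<close>\<close>
      define k where "k = Suc (nat \<lfloor>(l ! i - lo) / \<delta>\<rfloor>)"
      have lo: "lo \<le> l ! i" and hi: "l ! Suc i \<le> hi" using mem i by auto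
      have "0 \<le> (l ! i - lo) / \<delta>" using lo assms(4) by simp
      then have "real k = of_int \<lfloor>(l ! i - lo) / \<delta>\<rfloor> + 1" by (simp add: k_def)
      then have "(l ! i - lo) / \<delta> < real k" "real k \<le> (l ! i - lo) / \<delta> + 1" by linarith+
      then have k: "l ! i < lo + real k * \<delta>" "lo + real k * \<delta> \<le> l ! i + \<delta>"
        using assms(4) by (auto simp: field_simps)
      then have "real k * \<delta> \<le> hi - lo" using gap hi by linarith
      then have "real k \<le> (hi - lo) / \<delta>" using assms(4) by (simp add: field_simps)
      then have "k \<le> K" unfolding K_def by linarith
      then have "lo + real k * \<delta> \<in> U"
        using k gap lo hi unfolding U_def by auto
      then obtain m where m: "m \<le> M" "lo + real k * \<delta> = l ! m" using index by blast
      then show False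
        using k gap mono[of m i] mono[of "Suc i" m] i by (cases "m \<le> i") auto
    qed
  qed
qed

text \<open>
  Subtract the two instances of \<open>path_sum_on_grid\<close> for a grid through the points of both paths: the
  primitive \<open>A\<close> is Lipschitz on the grid with constant \<open>B\<close>, and the Stieltjes sums are compared
  term by term.
\<close>

lemma path_sum_diff_le:
  fixes g v :: "real \<Rightarrow> real" and y y' :: "nat \<Rightarrow> real"
  assumes major: "\<And>p q. p \<le> q \<Longrightarrow> \<bar>g q - g p\<bar> \<le> v q - v p"
    and y: "\<And>j. j \<le> N \<Longrightarrow> y j \<in> {lo..hi}" and y': "\<And>j. j \<le> N' \<Longrightarrow> y' j \<in> {lo..hi}"
    and bound: "\<And>z. z \<in> {lo..hi} \<Longrightarrow> \<bar>g z\<bar> \<le> B"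
    and close: "\<And>u. u \<in> {lo..hi} \<Longrightarrow> \<bar>path_local_time y N u - path_local_time y' N' u\<bar> \<le> e"
  shows "\<bar>path_sum g y N - path_sum g y' N'\<bar> \<le>
    B * (\<bar>y N - y' N'\<bar> + \<bar>y 0 - y' 0\<bar>) + e * (v hi - v lo)"
proof -
  have "lo \<le> hi" using y[of 0] by simp
  have Y: "y ` {..N} \<union> y' ` {..N'} \<subseteq> {lo..hi}" using y y' by blast
  obtain x M where x: "x 0 = lo" "x M = hi" "\<And>i. i < M \<Longrightarrow> x i \<le> x (Suc i)"
    and grid: "y ` {..N} \<union> y' ` {..N'} \<subseteq> x ` {..M}"
    by (rule fine_grid_exists[OF _ Y \<open>lo \<le> hi\<close> zero_less_one]) auto
  have mem: "x i \<in> {lo..hi}" if "i \<le> M" for i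
    using grid_mono[of M x 0 i] grid_mono[of M x i M] x that by auto
  define A where "A = (\<lambda>z. g (x 0) * z + (\<Sum>i<M. (g (x (Suc i)) - g (x i)) * max 0 (z - x (Suc i))))"
  define D where "D = (\<Sum>i<M. (g (x (Suc i)) - g (x i)) *
    (path_local_time y N (x (Suc i)) - path_local_time y' N' (x (Suc i))))"
  have lip_le: "\<bar>A (x l) - A (x k)\<bar> \<le> B * \<bar>x l - x k\<bar>" if kl: "k \<le> l" "l \<le> M" for k l
  proof -
    have "A (x l) - A (x k) = (\<Sum>i=k..<l. g (x i) * (x (Suc i) - x i))"
      unfolding A_def by (intro step_primitive_diff x(3) kl)
    also have "\<bar>\<dots>\<bar> \<le> (\<Sum>i=k..<l. B * (x (Suc i) - x i))"
      using kl x(3) bound mem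
      by (intro order_trans[OF sum_abs] sum_mono) (auto simp: abs_mult intro!: mult_right_mono)
    also have "\<dots> = B * (x l - x k)"
      using kl by (simp add: sum_distrib_left[symmetric] sum_Suc_diff')
    finally show ?thesis using grid_mono[of M x k l] x(3) kl by simp
  qed
  have lip: "\<bar>A a - A b\<bar> \<le> B * \<bar>a - b\<bar>" if ab: "a \<in> x ` {..M}" "b \<in> x ` {..M}" for a b
  proof -
    obtain k l where kl: "a = x k" "b = x l" "k \<le> M" "l \<le> M" using ab by auto
    show ?thesis
      using lip_le[of k l] lip_le[of l k] kl by (cases "k \<le> l") (auto simp: abs_minus_commute)
  qed
  have "path_sum g y N = A (y N) - A (y 0) -
      (\<Sum>i<M. (g (x (Suc i)) - g (x i)) * path_local_time y N (x (Suc i)))"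
    unfolding A_def using grid by (intro path_sum_on_grid x(3)) auto
  moreover have "path_sum g y' N' = A (y' N') - A (y' 0) -
      (\<Sum>i<M. (g (x (Suc i)) - g (x i)) * path_local_time y' N' (x (Suc i)))"
    unfolding A_def using grid by (intro path_sum_on_grid x(3)) auto
  ultimately have "path_sum g y N - path_sum g y' N' = (A (y N) - A (y' N')) - (A (y 0) - A (y' 0)) - D"
    unfolding D_def by (simp add: right_diff_distrib sum_subtractf)
  moreover have "\<bar>A (y N) - A (y' N')\<bar> \<le> B * \<bar>y N - y' N'\<bar>" "\<bar>A (y 0) - A (y' 0)\<bar> \<le> B * \<bar>y 0 - y' 0\<bar>"
    using grid by (auto intro!: lip)
  moreover have "\<bar>D\<bar> \<le> e * (v hi - v lo)"
  proof -
    have "\<bar>D\<bar> \<le> (\<Sum>i<M. (v (x (Suc i)) - v (x i)) * e)"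
      unfolding D_def using mem close x(3)
      by (intro order_trans[OF sum_abs] sum_mono)
        (auto simp: abs_mult intro!: mult_mono major order_trans[OF abs_ge_zero major])
    also have "\<dots> = (\<Sum>i<M. v (x (Suc i)) - v (x i)) * e"
      by (rule sum_distrib_right[symmetric])
    also have "\<dots> = e * (v hi - v lo)"
      using x sum_lessThan_telescope[of "\<lambda>i. v (x i)" M] by simp
    finally show ?thesis .
  qed
  ultimately show ?thesis by (simp add: distrib_left)
qed

section \<open>The change of variable formula for one partition\<close>

text \<open>
  The sum is the integral of the step function with value \<open>h (x (i + 1))\<close> on \<open>(x i, x (i + 1)]\<close>, which
  is within \<open>\<omega>\<close> of \<open>h\<close> on \<open>(lo, hi]\<close> and vanishes outside.
\<close>

lemma interval_measure_Riemann_sum_error: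
  fixes F h :: "real \<Rightarrow> real" and x :: "nat \<Rightarrow> real"
  assumes mono: "mono F" and rc: "\<And>a. continuous (at_right a) F"
    and cont: "continuous_on UNIV h" and supp: "\<And>u. u \<notin> {lo<..hi} \<Longrightarrow> h u = 0"
    and x: "x 0 = lo" "x M = hi" "\<And>i. i < M \<Longrightarrow> x i \<le> x (Suc i)"
    and osc: "\<And>i u. i < M \<Longrightarrow> u \<in> {x i<..x (Suc i)} \<Longrightarrow> \<bar>h u - h (x (Suc i))\<bar> \<le> \<omega>"
  shows "integrable (interval_measure F) h"
    and "\<bar>(LINT u|interval_measure F. h u) - (\<Sum>i<M. h (x (Suc i)) * (F (x (Suc i)) - F (x i)))\<bar>
          \<le> \<omega> * (F hi - F lo)"
proof -
  let ?\<mu> = "interval_measure F"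
  have monoD: "\<And>x y. x \<le> y \<Longrightarrow> F x \<le> F y" using mono by (auto simp: mono_def)
  have em: "emeasure ?\<mu> {a<..b} = ennreal (F b - F a)" if "a \<le> b" for a b
    using emeasure_interval_measure_Ioc[OF that monoD rc] by simp
  have ind: "integrable ?\<mu> (\<lambda>u. indicator {a<..b} u * c)"
    and int_ind: "(LINT u|?\<mu>. indicator {a<..b} u * c) = (F b - F a) * c" if "a \<le> b" for a b c :: real
    using em[OF that] measure_interval_measure_Ioc[OF that monoD rc] by auto
  have "lo \<le> hi" using grid_mono[of M x 0 M] x by simp
  have "bounded (h ` {lo..hi})"
    by (intro compact_imp_bounded compact_continuous_image continuous_on_subset[OF cont]) auto
  then obtain C where C: "\<And>u. u \<in> {lo..hi} \<Longrightarrow> \<bar>h u\<bar> \<le> C"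
    unfolding bounded_iff real_norm_def by blast
  have meas: "h \<in> borel_measurable ?\<mu>"
    using borel_measurable_continuous_onI[OF cont] by simp
  show int: "integrable ?\<mu> h"
  proof (rule integrableI_bounded_set[where A = "{lo<..hi}" and B = C])
    show "emeasure ?\<mu> {lo<..hi} < \<infinity>" using em[OF \<open>lo \<le> hi\<close>] by simp
  qed (use meas C supp in auto)
  have cover: "indicat_real {lo<..hi} u = (\<Sum>i<M. indicator {x i<..x (Suc i)} u)" for u
  proof -
    have "indicat_real {x 0<..x m} u = (\<Sum>i<m. indicator {x i<..x (Suc i)} u)" if "m \<le> M" for m
      using that
    proof (induction m)
      case (Suc m)
      then have "x 0 \<le> x m" "x m \<le> x (Suc m)" using grid_mono[of M x 0 m] x(3) by auto
      then have "indicat_real {x 0<..x (Suc m)} u = indicator {x 0<..x m} u + indicator {x m<..x (Suc m)} u"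
        by (auto simp: indicator_def)
      then show ?case using Suc by simp
    qed simp
    from this[of M] show ?thesis using x by simp
  qed
  let ?s = "\<lambda>u. \<Sum>i<M. indicator {x i<..x (Suc i)} u * h (x (Suc i))"
  have int_s: "integrable ?\<mu> ?s"
    using x(3) by (intro Bochner_Integration.integrable_sum ind) auto
  have "(LINT u|?\<mu>. ?s u) = (\<Sum>i<M. LINT u|?\<mu>. indicator {x i<..x (Suc i)} u * h (x (Suc i)))"
    by (intro Bochner_Integration.integral_sum ind) (auto simp: x(3))
  also have "\<dots> = (\<Sum>i<M. (F (x (Suc i)) - F (x i)) * h (x (Suc i)))"
    by (intro sum.cong refl int_ind) (auto simp: x(3))
  finally have "(\<Sum>i<M. h (x (Suc i)) * (F (x (Suc i)) - F (x i))) = (LINT u|?\<mu>. ?s u)"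
    by (simp add: mult.commute)
  then have "\<bar>(LINT u|?\<mu>. h u) - (\<Sum>i<M. h (x (Suc i)) * (F (x (Suc i)) - F (x i)))\<bar> =
      \<bar>LINT u|?\<mu>. h u - ?s u\<bar>"
    using int int_s by simp
  also have "\<dots> \<le> (LINT u|?\<mu>. \<bar>h u - ?s u\<bar>)"
    using integral_norm_bound[of ?\<mu> "\<lambda>u. h u - ?s u"] by simp
  also have "\<dots> \<le> (LINT u|?\<mu>. indicator {lo<..hi} u * \<omega>)"
  proof (rule integral_mono)
    fix u
    have "h u = indicator {lo<..hi} u * h u" using supp[of u] by (auto simp: indicator_def)
    also have "\<dots> = (\<Sum>i<M. indicator {x i<..x (Suc i)} u * h u)"
      unfolding cover by (rule sum_distrib_right)
    finally have "h u - ?s u = (\<Sum>i<M. indicator {x i<..x (Suc i)} u * (h u - h (x (Suc i))))"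
      by (simp add: right_diff_distrib sum_subtractf)
    also have "\<bar>\<dots>\<bar> \<le> (\<Sum>i<M. indicator {x i<..x (Suc i)} u * \<omega>)"
      using osc by (intro order_trans[OF sum_abs] sum_mono) (auto simp: indicator_def)
    also have "\<dots> = indicator {lo<..hi} u * \<omega>"
      unfolding cover by (rule sum_distrib_right[symmetric])
    finally show "\<bar>h u - ?s u\<bar> \<le> indicator {lo<..hi} u * \<omega>" .
  qed (use int int_s ind[OF \<open>lo \<le> hi\<close>] in auto)
  also have "\<dots> = \<omega> * (F hi - F lo)"
    using int_ind[OF \<open>lo \<le> hi\<close>] by simp
  finally show "\<bar>(LINT u|?\<mu>. h u) - (\<Sum>i<M. h (x (Suc i)) * (F (x (Suc i)) - F (x i)))\<bar>
      \<le> \<omega> * (F hi - F lo)" .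
qed

lemma LS_integral_Riemann_sum_error:
  fixes g h :: "real \<Rightarrow> real" and x :: "nat \<Rightarrow> real"
  assumes lbv: "locally_bounded_variation g" and rc: "right_continuous g"
    and cont: "continuous_on UNIV h" and supp: "\<And>u. u \<notin> {lo<..hi} \<Longrightarrow> h u = 0"
    and x: "x 0 = lo" "x M = hi" "\<And>i. i < M \<Longrightarrow> x i \<le> x (Suc i)"
    and osc: "\<And>i u. i < M \<Longrightarrow> u \<in> {x i<..x (Suc i)} \<Longrightarrow> \<bar>h u - h (x (Suc i))\<bar> \<le> \<omega>"
  shows "LS_integrable h g"
    and "\<bar>LS_integral h g - (\<Sum>i<M. (g (x (Suc i)) - g (x i)) * h (x (Suc i)))\<bar>
          \<le> \<omega> * (variation_function g hi - variation_function g lo)"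
proof -
  have rcg: "continuous (at_right a) g" for a using rc by (simp add: right_continuous_def)
  have rcp: "continuous (at_right a) (pos_variation g)" "continuous (at_right a) (neg_variation g)" for a
    unfolding pos_variation_def[abs_def] neg_variation_def[abs_def]
    using right_continuous_variation_function[OF lbv rc, of a] rcg[of a]
    by (auto intro!: continuous_intros)
  note P = interval_measure_Riemann_sum_error[OF mono_pos_variation[OF lbv] rcp(1) cont supp x osc]
  note Q = interval_measure_Riemann_sum_error[OF mono_neg_variation[OF lbv] rcp(2) cont supp x osc]
  show "LS_integrable h g" unfolding LS_integrable_def using P(1) Q(1) by blast
  have "(\<Sum>i<M. (g (x (Suc i)) - g (x i)) * h (x (Suc i))) =
      (\<Sum>i<M. h (x (Suc i)) * (pos_variation g (x (Suc i)) - pos_variation g (x i))) -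
      (\<Sum>i<M. h (x (Suc i)) * (neg_variation g (x (Suc i)) - neg_variation g (x i)))"
    unfolding sum_subtractf[symmetric]
    by (intro sum.cong) (auto simp: pos_variation_def neg_variation_def field_simps)
  moreover have "\<omega> * (variation_function g hi - variation_function g lo) =
      \<omega> * (pos_variation g hi - pos_variation g lo) + \<omega> * (neg_variation g hi - neg_variation g lo)"
    by (simp add: pos_variation_def neg_variation_def field_simps)
  ultimately show "\<bar>LS_integral h g - (\<Sum>i<M. (g (x (Suc i)) - g (x i)) * h (x (Suc i)))\<bar>
      \<le> \<omega> * (variation_function g hi - variation_function g lo)"
    unfolding LS_integral_def using P(2) Q(2) by linarith
qed

lemma left_endpoint_rule_error:
  fixes f g v :: "real \<Rightarrow> real"
  assumes rn: "has_RN_derivative f g"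
    and major: "\<And>p q. p \<le> q \<Longrightarrow> \<bar>g q - g p\<bar> \<le> v q - v p" and "a \<le> b"
  shows "\<bar>f b - f a - g a * (b - a)\<bar> \<le> (b - a) * (v b - v a)"
proof -
  have int: "set_integrable lborel {a..b} g" and f: "f b - f a = (LINT u:{a..b}|lborel. g u)"
    using rn \<open>a \<le> b\<close> by (auto simp: has_RN_derivative_def)
  have const: "set_integrable lborel {a..b} (\<lambda>_. c)" "(LINT u:{a..b}|lborel. c) = (b - a) * c" for c :: real
    using \<open>a \<le> b\<close> by (auto simp: set_integrable_def set_lebesgue_integral_def)
  have "\<bar>f b - f a - g a * (b - a)\<bar> = \<bar>LINT u:{a..b}|lborel. g u - g a\<bar>"
    using int const by (simp add: f set_integral_diff mult.commute)
  also have "\<dots> \<le> (LINT u:{a..b}|lborel. \<bar>g u - g a\<bar>)"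
    using set_integral_norm_bound[of lborel "{a..b}" "\<lambda>u. g u - g a"] int const by simp
  also have "\<dots> \<le> (LINT u:{a..b}|lborel. v b - v a)"
  proof (rule set_integral_mono)
    show "set_integrable lborel {a..b} (\<lambda>u. \<bar>g u - g a\<bar>)"
      using int const by (intro set_integrable_abs) simp
    show "\<bar>g u - g a\<bar> \<le> v b - v a" if "u \<in> {a..b}" for u
      using major[of a u] major[of u b] that by auto
  qed (rule const)
  also have "\<dots> = (b - a) * (v b - v a)" by (rule const)
  finally show ?thesis .
qed

text \<open>
  Three errors arise on a grid of mesh \<open>\<delta>\<close> through the sampled points: the step function's primitive
  \<open>A\<close> against \<open>f\<close>, the Stieltjes sum of \<open>h\<close> against its Lebesgue-Stieltjes integral, and the discrete
  local time against \<open>h\<close>. The first two vanish with the mesh while the path stays fixed, so only the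
  third one remains.
\<close>

lemma change_of_variable_error:
  fixes f g h :: "real \<Rightarrow> real" and y :: "nat \<Rightarrow> real"
  assumes lbv: "locally_bounded_variation g" and rc: "right_continuous g" and rn: "has_RN_derivative f g"
    and cont: "continuous_on UNIV h" and supp: "\<And>u. u \<notin> {lo<..hi} \<Longrightarrow> h u = 0"
    and y: "\<And>j. j \<le> N \<Longrightarrow> y j \<in> {lo..hi}"
    and close: "\<And>u. u \<in> {lo..hi} \<Longrightarrow> \<bar>path_local_time y N u - h u\<bar> \<le> e"
  shows "\<bar>path_sum g y N - (f (y N) - f (y 0) - LS_integral h g)\<bar>
    \<le> e * (variation_function g hi - variation_function g lo)"
proof -
  let ?v = "variation_function g"
  let ?W = "?v hi - ?v lo"
  note major = variation_function_majorant[OF lbv]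
  have "lo \<le> hi" using y[of 0] by simp
  have W: "0 \<le> ?W" using major[OF \<open>lo \<le> hi\<close>] by linarith
  have Y: "y ` {..N} \<subseteq> {lo..hi}" using y by blast
  have approx: "\<bar>path_sum g y N - (f (y N) - f (y 0) - LS_integral h g)\<bar> \<le> e * ?W + \<omega> * (2 * ?W)"
    if "\<omega> > 0" for \<omega>
  proof -
    have "uniformly_continuous_on {lo..hi} h"
      by (intro compact_uniformly_continuous continuous_on_subset[OF cont]) auto
    then obtain d where "d > 0"
      and d: "\<And>u u'. u \<in> {lo..hi} \<Longrightarrow> u' \<in> {lo..hi} \<Longrightarrow> dist u' u < d \<Longrightarrow> dist (h u') (h u) < \<omega>"
      unfolding uniformly_continuous_on_def using \<open>\<omega> > 0\<close> by metis
    define \<delta> where "\<delta> = min \<omega> (d / 2)"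
    have \<delta>: "\<delta> > 0" "\<delta> \<le> \<omega>" "\<delta> < d" using \<open>d > 0\<close> \<open>\<omega> > 0\<close> by (auto simp: \<delta>_def)
    obtain x M where x: "x 0 = lo" "x M = hi" "\<And>i. i < M \<Longrightarrow> x i \<le> x (Suc i)"
      and fine: "\<And>i. i < M \<Longrightarrow> x (Suc i) - x i \<le> \<delta>" and grid: "y ` {..N} \<subseteq> x ` {..M}"
      by (rule fine_grid_exists[OF _ Y \<open>lo \<le> hi\<close> \<open>\<delta> > 0\<close>]) auto
    have mem: "x i \<in> {lo..hi}" if "i \<le> M" for i
      using grid_mono[of M x 0 i] grid_mono[of M x i M] x that by auto
    have osc: "\<bar>h u - h (x (Suc i))\<bar> \<le> \<omega>" if i: "i < M" "u \<in> {x i<..x (Suc i)}" for i u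
      using d[of "x (Suc i)" u] mem[of i] mem[of "Suc i"] fine[of i] \<delta> i
      by (force simp: dist_real_def)
    define A where "A = (\<lambda>z. g (x 0) * z + (\<Sum>i<M. (g (x (Suc i)) - g (x i)) * max 0 (z - x (Suc i))))"
    have A_le: "\<bar>(f (x l) - f (x k)) - (A (x l) - A (x k))\<bar> \<le> \<omega> * ?W" if kl: "k \<le> l" "l \<le> M" for k l
    proof -
      have "A (x l) - A (x k) = (\<Sum>i=k..<l. g (x i) * (x (Suc i) - x i))"
        unfolding A_def by (intro step_primitive_diff x(3) kl)
      then have "(f (x l) - f (x k)) - (A (x l) - A (x k)) =
          (\<Sum>i=k..<l. f (x (Suc i)) - f (x i) - g (x i) * (x (Suc i) - x i))"
        using sum_Suc_diff'[OF kl(1), of "\<lambda>i. f (x i)"] by (simp add: sum_subtractf)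
      also have "\<bar>\<dots>\<bar> \<le> (\<Sum>i=k..<l. \<omega> * (?v (x (Suc i)) - ?v (x i)))"
      proof (rule order_trans[OF sum_abs sum_mono])
        fix i assume "i \<in> {k..<l}"
        then have i: "i < M" using kl by simp
        have "\<bar>f (x (Suc i)) - f (x i) - g (x i) * (x (Suc i) - x i)\<bar>
            \<le> (x (Suc i) - x i) * (?v (x (Suc i)) - ?v (x i))"
          by (rule left_endpoint_rule_error[OF rn major x(3)[OF i]])
        also have "\<dots> \<le> \<omega> * (?v (x (Suc i)) - ?v (x i))"
          using fine[OF i] \<delta> major[OF x(3)[OF i]] by (intro mult_right_mono) auto
        finally show "\<bar>f (x (Suc i)) - f (x i) - g (x i) * (x (Suc i) - x i)\<bar>
            \<le> \<omega> * (?v (x (Suc i)) - ?v (x i))" .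
      qed
      also have "\<dots> = \<omega> * (?v (x l) - ?v (x k))"
        using sum_Suc_diff'[OF kl(1), of "\<lambda>i. ?v (x i)"] by (simp add: sum_distrib_left[symmetric])
      also have "\<dots> \<le> \<omega> * ?W"
        using mem[of k] mem[of l] kl \<open>\<omega> > 0\<close> mono_variation_function[OF lbv]
        by (intro mult_left_mono diff_mono) (auto simp: mono_def)
      finally show ?thesis .
    qed
    have A: "\<bar>(f (y N) - f (y 0)) - (A (y N) - A (y 0))\<bar> \<le> \<omega> * ?W"
    proof -
      have "y N \<in> x ` {..M}" "y 0 \<in> x ` {..M}" using grid by auto
      then obtain k l where "y N = x k" "y 0 = x l" "k \<le> M" "l \<le> M"
        by (metis atMost_iff imageE)
      then show ?thesis using A_le[of k l] A_le[of l k] by (cases "k \<le> l") auto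
    qed
    have LS: "\<bar>LS_integral h g - (\<Sum>i<M. (g (x (Suc i)) - g (x i)) * h (x (Suc i)))\<bar> \<le> \<omega> * ?W"
      by (rule LS_integral_Riemann_sum_error(2)[OF lbv rc cont supp x osc])
    define D where "D = (\<Sum>i<M. (g (x (Suc i)) - g (x i)) * (path_local_time y N (x (Suc i)) - h (x (Suc i))))"
    have "\<bar>D\<bar> \<le> (\<Sum>i<M. (?v (x (Suc i)) - ?v (x i)) * e)"
      unfolding D_def using mem close x(3)
      by (intro order_trans[OF sum_abs] sum_mono)
        (auto simp: abs_mult intro!: mult_mono major order_trans[OF abs_ge_zero major])
    also have "\<dots> = (\<Sum>i<M. ?v (x (Suc i)) - ?v (x i)) * e"
      by (rule sum_distrib_right[symmetric])
    also have "\<dots> = e * ?W"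
      using x sum_lessThan_telescope[of "\<lambda>i. ?v (x i)" M] by simp
    finally have D: "\<bar>D\<bar> \<le> e * ?W" .
    have "path_sum g y N = A (y N) - A (y 0) -
        (\<Sum>i<M. (g (x (Suc i)) - g (x i)) * path_local_time y N (x (Suc i)))"
      unfolding A_def using grid by (intro path_sum_on_grid x(3)) auto
    also have "\<dots> = A (y N) - A (y 0) - (\<Sum>i<M. (g (x (Suc i)) - g (x i)) * h (x (Suc i))) - D"
      unfolding D_def by (simp add: right_diff_distrib sum_subtractf)
    finally have "path_sum g y N - (f (y N) - f (y 0) - LS_integral h g) =
        (LS_integral h g - (\<Sum>i<M. (g (x (Suc i)) - g (x i)) * h (x (Suc i))))
        - ((f (y N) - f (y 0)) - (A (y N) - A (y 0))) - D"
      by simp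
    also have "\<bar>\<dots>\<bar> \<le> \<omega> * ?W + \<omega> * ?W + e * ?W"
      using A LS D by linarith
    finally show ?thesis by (simp add: mult.left_commute)
  qed
  have "((\<lambda>\<omega>. e * ?W + \<omega> * (2 * ?W)) \<longlongrightarrow> e * ?W + 0 * (2 * ?W)) (at_right 0)"
    by (intro tendsto_intros)
  then have "\<bar>path_sum g y N - (f (y N) - f (y 0) - LS_integral h g)\<bar> \<le> e * ?W + 0 * (2 * ?W)"
    by (rule tendsto_lowerbound) (rule eventually_mono[OF eventually_at_right_less approx], auto)
  then show ?thesis by simp
qed

section \<open>Reduction of partition sums to sampled paths\<close>

text \<open>
  Infinitely many partition points in \<open>[0, t)\<close> would accumulate by the Bolzano-Weierstrass theorem.
\<close>

lemma finite_partition_before: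
  assumes p: "is_partition p"
  shows "finite {j. p j < ereal t}"
proof -
  have "p 0 = 0" and incr: "\<And>j. p j < \<infinity> \<Longrightarrow> p j < p (Suc j)" and top: "\<And>j. p j = \<infinity> \<Longrightarrow> p (Suc j) = \<infinity>"
    and acc: "\<And>x. 0 \<le> x \<Longrightarrow> \<not> x islimpt finite_points p"
    using p by (auto simp: is_partition_def)
  have "p j \<le> p (Suc j)" for j using incr[of j] top[of j] by (cases "p j = \<infinity>") auto
  then have mono: "incseq p" by (rule incseq_SucI)
  have nonneg: "0 \<le> p j" for j using incseqD[OF mono, of 0 j] \<open>p 0 = 0\<close> by simp
  have real: "ereal (real_of_ereal (p j)) = p j" if "p j < ereal t" for j
    using that nonneg[of j] by (cases "p j") auto
  have strict: "p i < p j" if "i < j" "p j < ereal t" for i j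
  proof -
    have "p i \<le> p j" using incseqD[OF mono] that by simp
    then have "p i < \<infinity>" using that by (cases "p i") auto
    then have "p i < p (Suc i)" by (rule incr)
    also have "\<dots> \<le> p j" using incseqD[OF mono] that by simp
    finally show ?thesis .
  qed
  have inj: "inj_on (\<lambda>j. real_of_ereal (p j)) {j. p j < ereal t}"
  proof (rule linorder_inj_onI')
    fix i j assume ij: "i \<in> {j. p j < ereal t}" "j \<in> {j. p j < ereal t}" "i < j"
    then show "real_of_ereal (p i) \<noteq> real_of_ereal (p j)"
      using strict[of i j] real[of i] real[of j] by (metis mem_Collect_eq less_irrefl)
  qed
  have sub: "(\<lambda>j. real_of_ereal (p j)) ` {j. p j < ereal t} \<subseteq> finite_points p \<inter> {0..t}"
  proof safe
    fix j assume j: "p j < ereal t"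
    show "real_of_ereal (p j) \<in> finite_points p"
      unfolding finite_points_def using real[OF j] by auto
    have "0 \<le> ereal (real_of_ereal (p j))" "ereal (real_of_ereal (p j)) < ereal t"
      using real[OF j] nonneg[of j] j by auto
    then show "real_of_ereal (p j) \<in> {0..t}" by simp
  qed
  have "finite (finite_points p \<inter> {0..t})"
  proof (rule ccontr)
    assume inf: "infinite (finite_points p \<inter> {0..t})"
    obtain x where "x \<in> {0..t}" "x islimpt (finite_points p \<inter> {0..t})"
      using Heine_Borel_imp_Bolzano_Weierstrass[OF compact_Icc inf Int_lower2] by blast
    then show False using acc[of x] islimpt_subset[of x _ "finite_points p"] by auto
  qed
  then show ?thesis
    using finite_imageD[OF finite_subset[OF sub] inj] by blast
qed

text \<open>
  Beyond the last partition point before \<open>t\<close> the stopped times all equal \<open>t\<close>, so that the remaining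
  terms vanish. The same sampled path serves all integrands \<open>g\<close> and all levels \<open>u\<close>.
\<close>

lemma discrete_path_exists:
  fixes S :: "real \<Rightarrow> real"
  assumes p: "is_partition p" and t: "0 \<le> t"
  obtains y :: "nat \<Rightarrow> real" and N where "y 0 = S 0" "y N = S t" "\<And>j. y j \<in> S ` {0..t}"
    "\<And>g. riemann_sum p g S t = path_sum g y N"
    "\<And>u. discrete_local_time p S t u = path_local_time y N u"
proof -
  obtain N where "{j. p j < ereal t} \<subseteq> {..<N}"
    using finite_partition_before[OF p, of t] finite_nat_iff_bounded by blast
  then have N: "ereal t \<le> p j" if "j \<ge> N" for j
    using that by (force simp: not_less[symmetric])
  have "p 0 = 0" and incr: "\<And>j. p j < \<infinity> \<Longrightarrow> p j < p (Suc j)" and top: "\<And>j. p j = \<infinity> \<Longrightarrow> p (Suc j) = \<infinity>"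
    using p by (auto simp: is_partition_def)
  have le: "p j \<le> p (Suc j)" for j using incr[of j] top[of j] by (cases "p j = \<infinity>") auto
  have nonneg: "0 \<le> p j" for j using incseqD[OF incseq_SucI, of p 0 j] le \<open>p 0 = 0\<close> by auto
  let ?y = "\<lambda>j. S (stopped p t j)"
  have late: "stopped p t j = t" if "ereal t \<le> p j" for j
    using that by (simp add: stopped_def min_absorb2)
  have early: "stopped p t j = real_of_ereal (p j)" if "p j < ereal t" for j
    using that by (simp add: stopped_def min_absorb1)
  have const: "?y (Suc j) = ?y j" if "ereal t \<le> p j" for j
    using late[OF that] late[OF order_trans[OF that le]] by simp
  have J: "J_interval a a = {}" for a by (simp add: J_interval_def)
  have term_early: "j \<in> finite_indices p" if "p j < ereal t" for j
    using that unfolding finite_indices_def by (cases "p j") auto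
  show thesis
  proof (rule that[of ?y N])
    show "?y 0 = S 0" using t \<open>p 0 = 0\<close> by (simp add: stopped_def min_absorb1)
    show "?y N = S t" using late N by simp
    show "?y j \<in> S ` {0..t}" for j
      using nonneg[of j] t by (cases "p j") (auto simp: stopped_def min_def zero_ereal_def)
    show "riemann_sum p g S t = path_sum g ?y N" for g
    proof -
      have "riemann_sum p g S t = (\<Sum>\<^sub>\<infinity>j\<in>{..<N}. g (?y j) * (?y (Suc j) - ?y j))"
        unfolding riemann_sum_def
      proof (rule infsum_cong_neutral)
        fix j assume "j \<in> {..<N} - finite_indices p"
        then have "ereal t \<le> p j" using term_early[of j] by (auto simp: not_less[symmetric])
        then show "g (?y j) * (?y (Suc j) - ?y j) = 0" using const by simp
      next
        fix j assume "j \<in> finite_indices p - {..<N}"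
        then show "g (S (real_of_ereal (p j))) * (?y (Suc j) - ?y j) = 0"
          using const[OF N] by simp
      next
        fix j
        show "g (S (real_of_ereal (p j))) * (?y (Suc j) - ?y j) = g (?y j) * (?y (Suc j) - ?y j)"
          using early[of j] const[of j] by (cases "p j < ereal t") auto
      qed
      then show ?thesis by (simp add: path_sum_def)
    qed
    show "discrete_local_time p S t u = path_local_time ?y N u" for u
    proof -
      have "discrete_local_time p S t u =
          (\<Sum>\<^sub>\<infinity>j\<in>{..<N}. indicator (J_interval (?y j) (?y (Suc j))) u * \<bar>?y (Suc j) - u\<bar>)"
        unfolding discrete_local_time_def
      proof (rule infsum_cong_neutral)
        fix j assume "j \<in> {..<N} - finite_indices p"
        then have "ereal t \<le> p j" using term_early[of j] by (auto simp: not_less[symmetric])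
        then show "indicator (J_interval (?y j) (?y (Suc j))) u * \<bar>?y (Suc j) - u\<bar> = 0"
          using const by (simp add: J)
      next
        fix j assume "j \<in> finite_indices p - {..<N}"
        then show "indicator (J_interval (?y j) (?y (Suc j))) u * \<bar>?y (Suc j) - u\<bar> = 0"
          using const[OF N] by (simp add: J)
      qed simp
      then show ?thesis by (simp add: path_local_time_def)
    qed
  qed
qed

lemma path_local_time_outside:
  assumes "\<And>j. j \<le> N \<Longrightarrow> y j \<in> {lo..hi}" "u \<notin> {lo<..hi}"
  shows "path_local_time y N u = 0"
  unfolding path_local_time_def
proof (rule sum.neutral, safe)
  fix j assume "j < N"
  then have "y j \<in> {lo..hi}" "y (Suc j) \<in> {lo..hi}" using assms(1) by auto
  then have "u \<notin> J_interval (y j) (y (Suc j))"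
    using assms(2) by (auto simp: J_interval_def)
  then show "indicator (J_interval (y j) (y (Suc j))) u * \<bar>y (Suc j) - u\<bar> = 0" by simp
qed

lemma discrete_local_time_outside:
  assumes "is_partition p" "0 \<le> t" "S ` {0..t} \<subseteq> {lo..hi}" "u \<notin> {lo<..hi}"
  shows "discrete_local_time p S t u = 0"
proof -
  obtain y N where y: "\<And>j. y j \<in> S ` {0..t}" "\<And>u. discrete_local_time p S t u = path_local_time y N u"
    using discrete_path_exists[OF assms(1,2), of S] by metis
  show ?thesis
    unfolding y(2) by (rule path_local_time_outside[OF _ assms(4)]) (use y(1) assms(3) in blast)
qed

lemma partition_sums_at_zero:
  assumes "is_partition p"
  shows "riemann_sum p g S 0 = 0" "discrete_local_time p S 0 u = 0"
proof -
  obtain y N where y: "\<And>j. y j \<in> S ` {0..0}" "\<And>g. riemann_sum p g S 0 = path_sum g y N"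
    "\<And>u. discrete_local_time p S 0 u = path_local_time y N u"
    using discrete_path_exists[OF assms order_refl, of S] by metis
  then have "y j = S 0" for j by auto
  then show "riemann_sum p g S 0 = 0" "discrete_local_time p S 0 u = 0"
    by (simp_all add: y path_sum_def path_local_time_def J_interval_def)
qed

lemma riemann_sum_add:
  assumes "is_partition p" "0 \<le> t"
  shows "riemann_sum p (\<lambda>x. g x + h x) S t = riemann_sum p g S t + riemann_sum p h S t"
proof -
  obtain y N where y: "\<And>g. riemann_sum p g S t = path_sum g y N"
    using discrete_path_exists[OF assms, of S] by metis
  show ?thesis unfolding y path_sum_def by (simp add: distrib_right sum.distrib)
qed

lemma riemann_sum_scale:
  assumes "is_partition p" "0 \<le> t"
  shows "riemann_sum p (\<lambda>x. c * g x) S t = c * riemann_sum p g S t"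
proof -
  obtain y N where y: "\<And>g. riemann_sum p g S t = path_sum g y N"
    using discrete_path_exists[OF assms, of S] by metis
  show ?thesis unfolding y path_sum_def by (simp add: sum_distrib_left mult.assoc)
qed

lemma riemann_sum_diff_le:
  fixes S g v :: "real \<Rightarrow> real"
  assumes p: "is_partition p" and q: "is_partition q" and t: "t \<in> {0..T}" and s: "s \<in> {0..T}"
    and S: "S ` {0..T} \<subseteq> {lo..hi}"
    and major: "\<And>a b. a \<le> b \<Longrightarrow> \<bar>g b - g a\<bar> \<le> v b - v a"
    and bound: "\<And>z. z \<in> {lo..hi} \<Longrightarrow> \<bar>g z\<bar> \<le> B"
    and close: "\<And>u. u \<in> {lo..hi} \<Longrightarrow> \<bar>discrete_local_time p S t u - discrete_local_time q S s u\<bar> \<le> e"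
  shows "\<bar>riemann_sum p g S t - riemann_sum q g S s\<bar> \<le> B * \<bar>S t - S s\<bar> + e * (v hi - v lo)"
proof -
  have range: "S ` {0..t} \<subseteq> {lo..hi}" "S ` {0..s} \<subseteq> {lo..hi}" using S t s by (auto simp: image_subset_iff)
  obtain y N where y: "y 0 = S 0" "y N = S t" "\<And>j. y j \<in> S ` {0..t}"
    "\<And>g. riemann_sum p g S t = path_sum g y N" "\<And>u. discrete_local_time p S t u = path_local_time y N u"
    using discrete_path_exists[OF p, of t S] t by (metis atLeastAtMost_iff)
  obtain z M where z: "z 0 = S 0" "z M = S s" "\<And>j. z j \<in> S ` {0..s}"
    "\<And>g. riemann_sum q g S s = path_sum g z M" "\<And>u. discrete_local_time q S s u = path_local_time z M u"
    using discrete_path_exists[OF q, of s S] s by (metis atLeastAtMost_iff)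
  have "\<bar>path_sum g y N - path_sum g z M\<bar> \<le> B * (\<bar>y N - z M\<bar> + \<bar>y 0 - z 0\<bar>) + e * (v hi - v lo)"
  proof (rule path_sum_diff_le[OF major _ _ bound])
    show "y j \<in> {lo..hi}" for j using y(3) range(1) by blast
    show "z j \<in> {lo..hi}" for j using z(3) range(2) by blast
    show "\<bar>path_local_time y N u - path_local_time z M u\<bar> \<le> e" if "u \<in> {lo..hi}" for u
      using close[OF that] by (simp add: y(5) z(5))
  qed
  then show ?thesis using y z by simp
qed

section \<open>Passage to the limit\<close>

lemma uniform_limit_abs_le:
  fixes F :: "nat \<Rightarrow> 'a \<Rightarrow> real"
  assumes "uniform_limit A F l sequentially" "\<eta> > 0"
  shows "\<forall>\<^sub>F n in sequentially. \<forall>u\<in>A. \<bar>F n u - l u\<bar> \<le> \<eta>"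
  using uniform_limitD[OF assms] by eventually_elim (auto simp: dist_real_def less_imp_le)

lemma bounded_range_on_Icc:
  fixes S :: "real \<Rightarrow> real"
  assumes "continuous_on {0..} S"
  obtains lo hi where "lo \<le> hi" "S ` {0..T} \<subseteq> {lo..hi}"
proof -
  have "bounded (S ` {0..T})"
    by (intro compact_imp_bounded compact_continuous_image continuous_on_subset[OF assms]) auto
  then obtain C where C: "\<And>t. t \<in> {0..T} \<Longrightarrow> \<bar>S t\<bar> \<le> C"
    unfolding bounded_iff real_norm_def by blast
  then have "S ` {0..T} \<subseteq> {-\<bar>C\<bar>..\<bar>C\<bar>}" by (force simp: abs_le_iff)
  then show thesis using that[of "-\<bar>C\<bar>" "\<bar>C\<bar>"] by simp
qed

lemma majorized_bound:
  fixes g v :: "real \<Rightarrow> real"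
  assumes "\<And>a b. a \<le> b \<Longrightarrow> \<bar>g b - g a\<bar> \<le> v b - v a" "z \<in> {lo..hi}"
  shows "\<bar>g z\<bar> \<le> \<bar>g lo\<bar> + (v hi - v lo)"
  using assms(1)[of lo z] assms(1)[of z hi] assms(2) by auto

text \<open>
  The discrete local times are uniformly Cauchy, hence by \<open>riemann_sum_diff_le\<close> the Riemann sums are
  Cauchy. This identifies no limit, but covers integrands that are not right-continuous.
\<close>

lemma convergent_riemann_sums:
  fixes S :: "real \<Rightarrow> real"
  assumes part: "\<And>n. is_partition (\<pi> n)" and S: "continuous_on {0..} S" and t: "0 \<le> t"
    and lim: "uniform_limit UNIV (\<lambda>n. discrete_local_time (\<pi> n) S t) l sequentially"
    and lbv: "locally_bounded_variation g"
  shows "convergent (\<lambda>n. riemann_sum (\<pi> n) g S t)"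
proof -
  let ?v = "variation_function g"
  note major = variation_function_majorant[OF lbv]
  obtain lo hi where lohi: "lo \<le> hi" "S ` {0..t} \<subseteq> {lo..hi}"
    using bounded_range_on_Icc[OF S] by blast
  define W where "W = ?v hi - ?v lo"
  have W: "0 \<le> W" using major[OF lohi(1)] by (simp add: W_def)
  have "Cauchy (\<lambda>n. riemann_sum (\<pi> n) g S t)"
  proof (rule metric_CauchyI)
    fix \<epsilon> :: real assume "\<epsilon> > 0"
    \<comment> \<open>adding \<open>1\<close> keeps the factor positive when \<open>g\<close> is constant on the range of \<open>S\<close>\<close>
    define c where "c = 2 * (W + 1)"
    define \<eta> where "\<eta> = \<epsilon> / c"
    have "c > 0" using W by (simp add: c_def)
    then have "\<eta> > 0" using \<open>\<epsilon> > 0\<close> by (simp add: \<eta>_def)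
    obtain k where k: "\<And>n u. n \<ge> k \<Longrightarrow> \<bar>discrete_local_time (\<pi> n) S t u - l u\<bar> \<le> \<eta>"
      using uniform_limit_abs_le[OF lim \<open>\<eta> > 0\<close>] unfolding eventually_sequentially by blast
    have "dist (riemann_sum (\<pi> m) g S t) (riemann_sum (\<pi> n) g S t) < \<epsilon>" if mn: "m \<ge> k" "n \<ge> k" for m n
    proof -
      have "\<bar>riemann_sum (\<pi> m) g S t - riemann_sum (\<pi> n) g S t\<bar>
          \<le> (\<bar>g lo\<bar> + (?v hi - ?v lo)) * \<bar>S t - S t\<bar> + (2 * \<eta>) * (?v hi - ?v lo)"
      proof (rule riemann_sum_diff_le[OF part part _ _ lohi(2) major majorized_bound[OF major]])
        show "\<bar>discrete_local_time (\<pi> m) S t u - discrete_local_time (\<pi> n) S t u\<bar> \<le> 2 * \<eta>" for u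
          using k[OF mn(1), of u] k[OF mn(2), of u] by linarith
      qed (use t in auto)
      also have "\<dots> = 2 * \<eta> * W" by (simp add: W_def)
      also have "\<dots> < \<eta> * c" using \<open>\<eta> > 0\<close> by (simp add: c_def)
      also have "\<dots> = \<epsilon>" using \<open>c > 0\<close> by (simp add: \<eta>_def)
      finally show ?thesis by (simp add: dist_real_def)
    qed
    then show "\<exists>k. \<forall>m\<ge>k. \<forall>n\<ge>k. dist (riemann_sum (\<pi> m) g S t) (riemann_sum (\<pi> n) g S t) < \<epsilon>" by blast
  qed
  then show ?thesis by (rule Cauchy_convergent)
qed

text \<open>
  The local time inherits from the discrete ones that it vanishes off the range of \<open>S\<close>, so that
  \<open>change_of_variable_error\<close> applies with \<open>h\<close> the limit local time and \<open>e\<close> tending to \<open>0\<close>.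
\<close>

lemma riemann_sums_tendsto_change_of_variable:
  fixes S f g :: "real \<Rightarrow> real"
  assumes part: "\<And>n. is_partition (\<pi> n)" and S: "continuous_on {0..} S" and t: "0 \<le> t"
    and lim: "uniform_limit UNIV (\<lambda>n. discrete_local_time (\<pi> n) S t) l sequentially"
    and cont: "continuous_on UNIV l"
    and lbv: "locally_bounded_variation g" and rc: "right_continuous g" and rn: "has_RN_derivative f g"
  shows "LS_integrable l g"
    and "(\<lambda>n. riemann_sum (\<pi> n) g S t) \<longlonglongrightarrow> f (S t) - f (S 0) - LS_integral l g"
proof -
  let ?v = "variation_function g"
  obtain lo hi where lohi: "lo \<le> hi" "S ` {0..t} \<subseteq> {lo..hi}"
    using bounded_range_on_Icc[OF S] by blast
  define W where "W = ?v hi - ?v lo"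
  have W: "0 \<le> W" using variation_function_majorant[OF lbv lohi(1)] by (simp add: W_def)
  have supp: "l u = 0" if "u \<notin> {lo<..hi}" for u
    using tendsto_uniform_limitI[OF lim, of u] discrete_local_time_outside[OF part t lohi(2) that]
    by (simp add: LIMSEQ_const_iff)
  have "bounded (l ` {lo..hi})"
    by (intro compact_imp_bounded compact_continuous_image continuous_on_subset[OF cont]) auto
  then obtain C where C: "\<And>u. u \<in> {lo..hi} \<Longrightarrow> \<bar>l u\<bar> \<le> C"
    unfolding bounded_iff real_norm_def by blast
  \<comment> \<open>integrability follows from the trivial grid with the two points \<open>lo\<close> and \<open>hi\<close>\<close>
  show "LS_integrable l g"
  proof (rule LS_integral_Riemann_sum_error(1)[where x = "\<lambda>i. if i = 0 then lo else hi"
        and M = 1 and \<omega> = "2 * C", OF lbv rc cont supp])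
    fix i :: nat and u assume "i < 1" "u \<in> {(if i = 0 then lo else hi)<..(if Suc i = 0 then lo else hi)}"
    then have "\<bar>l u\<bar> \<le> C" "\<bar>l hi\<bar> \<le> C" using C lohi(1) by auto
    then show "\<bar>l u - l (if Suc i = 0 then lo else hi)\<bar> \<le> 2 * C" by simp
  qed (use lohi in auto)
  show "(\<lambda>n. riemann_sum (\<pi> n) g S t) \<longlonglongrightarrow> f (S t) - f (S 0) - LS_integral l g"
  proof (rule tendstoI)
    fix \<epsilon> :: real assume "\<epsilon> > 0"
    define \<eta> where "\<eta> = \<epsilon> / (W + 1)"
    have "\<eta> > 0" using \<open>\<epsilon> > 0\<close> W by (simp add: \<eta>_def)
    from uniform_limit_abs_le[OF lim this]
    show "\<forall>\<^sub>F n in sequentially. dist (riemann_sum (\<pi> n) g S t) (f (S t) - f (S 0) - LS_integral l g) < \<epsilon>"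
    proof eventually_elim
      case (elim n)
      obtain y N where y: "y 0 = S 0" "y N = S t" "\<And>j. y j \<in> S ` {0..t}"
        "\<And>g. riemann_sum (\<pi> n) g S t = path_sum g y N"
        "\<And>u. discrete_local_time (\<pi> n) S t u = path_local_time y N u"
        using discrete_path_exists[OF part t, of S] by metis
      have range: "y j \<in> {lo..hi}" for j using y(3) lohi(2) by blast
      have "\<bar>path_sum g y N - (f (y N) - f (y 0) - LS_integral l g)\<bar> \<le> \<eta> * (?v hi - ?v lo)"
        using elim by (intro change_of_variable_error[OF lbv rc rn cont supp range]) (auto simp flip: y(5))
      also have "\<dots> < \<eta> * (W + 1)" using \<open>\<eta> > 0\<close> by (simp add: W_def)
      also have "\<dots> = \<epsilon>" using W by (simp add: \<eta>_def)
      finally show ?case by (simp add: y dist_real_def)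
    qed
  qed
qed

lemma pathwise_integral_diff_le:
  fixes S g v :: "real \<Rightarrow> real"
  assumes part: "\<And>n. is_partition (\<pi> n)" and t: "t \<in> {0..T}" and s: "s \<in> {0..T}"
    and S: "S ` {0..T} \<subseteq> {lo..hi}"
    and lim: "\<And>t. 0 \<le> t \<Longrightarrow> uniform_limit UNIV (\<lambda>n. discrete_local_time (\<pi> n) S t) (L t) sequentially"
    and int: "\<And>t. 0 \<le> t \<Longrightarrow> pathwise_integrable \<pi> g S t"
    and major: "\<And>a b. a \<le> b \<Longrightarrow> \<bar>g b - g a\<bar> \<le> v b - v a"
    and bound: "\<And>z. z \<in> {lo..hi} \<Longrightarrow> \<bar>g z\<bar> \<le> B"
    and close: "\<And>u. u \<in> {lo..hi} \<Longrightarrow> \<bar>L t u - L s u\<bar> \<le> e"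
  shows "\<bar>pathwise_integral \<pi> g S t - pathwise_integral \<pi> g S s\<bar> \<le> B * \<bar>S t - S s\<bar> + e * (v hi - v lo)"
proof -
  have conv: "(\<lambda>n. riemann_sum (\<pi> n) g S r) \<longlonglongrightarrow> pathwise_integral \<pi> g S r" if "0 \<le> r" for r
    using int[OF that] unfolding pathwise_integrable_def pathwise_integral_def convergent_LIMSEQ_iff .
  have nonneg: "0 \<le> t" "0 \<le> s" using t s by auto
  have approx: "\<bar>pathwise_integral \<pi> g S t - pathwise_integral \<pi> g S s\<bar>
      \<le> B * \<bar>S t - S s\<bar> + (e + 2 * \<eta>) * (v hi - v lo)" if "\<eta> > 0" for \<eta>
  proof (rule tendsto_upperbound)
    show "(\<lambda>n. \<bar>riemann_sum (\<pi> n) g S t - riemann_sum (\<pi> n) g S s\<bar>) \<longlonglongrightarrow>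
        \<bar>pathwise_integral \<pi> g S t - pathwise_integral \<pi> g S s\<bar>"
      using nonneg by (intro tendsto_rabs tendsto_diff conv)
    show "\<forall>\<^sub>F n in sequentially. \<bar>riemann_sum (\<pi> n) g S t - riemann_sum (\<pi> n) g S s\<bar>
        \<le> B * \<bar>S t - S s\<bar> + (e + 2 * \<eta>) * (v hi - v lo)"
      using uniform_limit_abs_le[OF lim[OF nonneg(1)] that] uniform_limit_abs_le[OF lim[OF nonneg(2)] that]
    proof eventually_elim
      case (elim n)
      show ?case
      proof (rule riemann_sum_diff_le[OF part part t s S major bound])
        fix u assume u: "u \<in> {lo..hi}"
        show "\<bar>discrete_local_time (\<pi> n) S t u - discrete_local_time (\<pi> n) S s u\<bar> \<le> e + 2 * \<eta>"
          using bspec[OF elim(1), of u] bspec[OF elim(2), of u] close[OF u] by auto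
      qed
    qed
  qed simp
  have "((\<lambda>\<eta>. B * \<bar>S t - S s\<bar> + (e + 2 * \<eta>) * (v hi - v lo)) \<longlongrightarrow>
      B * \<bar>S t - S s\<bar> + (e + 2 * 0) * (v hi - v lo)) (at_right 0)"
    by (intro tendsto_intros)
  then have "\<bar>pathwise_integral \<pi> g S t - pathwise_integral \<pi> g S s\<bar>
      \<le> B * \<bar>S t - S s\<bar> + (e + 2 * 0) * (v hi - v lo)"
    by (rule tendsto_lowerbound) (rule eventually_mono[OF eventually_at_right_less approx], auto)
  then show ?thesis by simp
qed

section \<open>Functions of bounded variation on the real line\<close>

lemma BV_imp_locally_bounded_variation:
  assumes "g \<in> BV"
  shows "locally_bounded_variation g"
  unfolding locally_bounded_variation_def
proof (intro allI)
  fix a b :: real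
  show "bounded_variation_on g {a..b}"
  proof (cases "a \<le> b")
    case True
    then show ?thesis using assms total_variation_mono(1)[of g UNIV "{a..b}"] by (auto simp: BV_def)
  next
    case False
    then have "variation_sums g {a..b} = {}" by (auto simp: variation_sums_def)
    then show ?thesis by (simp add: bounded_variation_on_def)
  qed
qed

lemma mono_bounded_tendsto_at_bot:
  fixes F :: "real \<Rightarrow> real"
  assumes "mono F" "\<And>x. c \<le> F x"
  shows "(F \<longlongrightarrow> Inf (range F)) at_bot"
proof (rule decreasing_tendsto)
  have bdd: "bdd_below (range F)" using assms(2) by (intro bdd_belowI[of _ c]) auto
  show "\<forall>\<^sub>F x in at_bot. Inf (range F) \<le> F x"
    using bdd by (intro always_eventually) (auto intro: cInf_lower)
  fix r assume "Inf (range F) < r"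
  then obtain z where "F z < r" using cInf_lessD[of "range F" r] by auto
  then show "\<forall>\<^sub>F x in at_bot. F x < r"
    using assms(1) unfolding eventually_at_bot_linorder mono_def by (meson le_less_trans)
qed

text \<open>
  The norm involves the default-valued \<open>Lim at_bot g\<close>, so the existence of the limit of \<open>g\<close> at
  \<open>-\<infinity>\<close> has to be shown: \<open>g\<close> is a difference of two nondecreasing functions that are bounded below.
\<close>

lemma BV_norm_bounds:
  assumes g: "g \<in> BV"
  shows "\<bar>g z\<bar> \<le> BV_norm g" and "a \<le> b \<Longrightarrow> variation_function g b - variation_function g a \<le> BV_norm g"
proof -
  let ?v = "variation_function g" and ?U = "total_variation g UNIV"
  have bv: "bounded_variation_on g UNIV" using g by (simp add: BV_def)
  note lbv = BV_imp_locally_bounded_variation[OF g]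
  have v_le: "?v y - ?v x \<le> ?U" if "x \<le> y" for x y
    using variation_function_diff[OF lbv that] total_variation_mono(2)[OF bv, of "{x..y}"] that by auto
  have abs_le: "\<bar>g y - g x\<bar> \<le> ?U" for x y
    using variation_function_majorant[OF lbv, of x y] variation_function_majorant[OF lbv, of y x]
      v_le[of x y] v_le[of y x] by (cases "x \<le> y") auto
  have v_low: "- ?U \<le> ?v x" for x
    using v_le[of 0 x] v_le[of x 0] mono_variation_function[OF lbv] variation_function_majorant[OF lbv, of 0 x]
      variation_function_majorant[OF lbv, of x 0]
    by (cases "0 \<le> x") (auto simp: variation_function_def)
  have pos_low: "(g 0 - 2 * ?U) / 2 \<le> pos_variation g x" for x
    using v_low[of x] abs_le[of x 0] abs_le[of 0 0] by (auto simp: pos_variation_def)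
  have neg_low: "(- g 0 - 2 * ?U) / 2 \<le> neg_variation g x" for x
    using v_low[of x] abs_le[of x 0] abs_le[of 0 0] by (auto simp: neg_variation_def)
  define l where "l = Inf (range (pos_variation g)) - Inf (range (neg_variation g))"
  have "((\<lambda>x. pos_variation g x - neg_variation g x) \<longlongrightarrow> l) at_bot"
    unfolding l_def
    by (intro tendsto_diff mono_bounded_tendsto_at_bot[OF _ pos_low] mono_bounded_tendsto_at_bot[OF _ neg_low]
        mono_pos_variation mono_neg_variation lbv)
  moreover have "(\<lambda>x. pos_variation g x - neg_variation g x) = g"
    by (auto simp: pos_variation_def neg_variation_def field_simps)
  ultimately have l: "(g \<longlongrightarrow> l) at_bot" by simp
  then have "Lim at_bot g = l" by (intro tendsto_Lim) auto
  moreover have "\<bar>g z - l\<bar> \<le> ?U"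
    by (rule tendsto_upperbound[of "\<lambda>x. \<bar>g z - g x\<bar>" _ at_bot])
      (auto intro!: tendsto_intros l always_eventually abs_le)
  ultimately show "\<bar>g z\<bar> \<le> BV_norm g" by (simp add: BV_norm_def)
  show "?v b - ?v a \<le> BV_norm g" if "a \<le> b"
    using v_le[OF that] by (simp add: BV_norm_def)
qed

section \<open>The pathwise integral as a bounded operator\<close>

lemma pathwise_integral_zero_time:
  assumes "\<And>n. is_partition (\<pi> n)"
  shows "pathwise_integral \<pi> g S 0 = 0"
  using partition_sums_at_zero(1)[OF assms] by (simp add: pathwise_integral_def)

text \<open>
  The estimate \<open>pathwise_integral_diff_le\<close> gives continuity, as \<open>L\<close> is uniformly continuous on
  \<open>[0, T] \<times> [lo, hi]\<close>, and the bound on the operator norm by comparison with time \<open>0\<close>, where both the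
  integral and the local time vanish. The resulting constant is the length of an interval containing
  \<open>S ` [0, T]\<close> plus a bound on the absolute value of the local time.
\<close>

lemma pathwise_integral_bounded_linear:
  fixes S :: "real \<Rightarrow> real" and L :: "real \<Rightarrow> real \<Rightarrow> real"
  assumes part: "\<And>n. is_partition (\<pi> n)" and S: "continuous_on {0..} S"
    and lim: "\<And>t. 0 \<le> t \<Longrightarrow> uniform_limit UNIV (\<lambda>n. discrete_local_time (\<pi> n) S t) (L t) sequentially"
    and L: "continuous_on ({0..} \<times> UNIV) (\<lambda>(t, u). L t u)" and T: "T > 0"
  shows "bounded_linear_BV_C T (\<lambda>g. pathwise_integral \<pi> g S)"
proof -
  let ?\<Phi> = "\<lambda>g. pathwise_integral \<pi> g S"
  have int: "pathwise_integrable \<pi> g S t" if "g \<in> BV" "0 \<le> t" for g t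
    unfolding pathwise_integrable_def
    using convergent_riemann_sums[OF part S that(2) lim[OF that(2)]] BV_imp_locally_bounded_variation that(1) by blast
  have conv: "(\<lambda>n. riemann_sum (\<pi> n) g S t) \<longlonglongrightarrow> ?\<Phi> g t" if "g \<in> BV" "0 \<le> t" for g t
    using int[OF that] unfolding pathwise_integrable_def pathwise_integral_def convergent_LIMSEQ_iff .
  obtain lo hi where lohi: "lo \<le> hi" "S ` {0..T} \<subseteq> {lo..hi}"
    using bounded_range_on_Icc[OF S] by blast
  have cont: "continuous_on ({0..T} \<times> {lo..hi}) (\<lambda>(t, u). L t u)"
    by (rule continuous_on_subset[OF L]) auto
  have diff: "\<bar>?\<Phi> g t - ?\<Phi> g s\<bar> \<le> BV_norm g * \<bar>S t - S s\<bar> + e * BV_norm g"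
    if "g \<in> BV" "t \<in> {0..T}" "s \<in> {0..T}" "0 \<le> e" "\<And>u. u \<in> {lo..hi} \<Longrightarrow> \<bar>L t u - L s u\<bar> \<le> e" for g t s e
  proof -
    let ?v = "variation_function g"
    have "\<bar>?\<Phi> g t - ?\<Phi> g s\<bar> \<le> BV_norm g * \<bar>S t - S s\<bar> + e * (?v hi - ?v lo)"
      using that int
      by (intro pathwise_integral_diff_le[OF part _ _ lohi(2) lim]
          variation_function_majorant BV_imp_locally_bounded_variation BV_norm_bounds(1)) auto
    also have "\<dots> \<le> BV_norm g * \<bar>S t - S s\<bar> + e * BV_norm g"
      using that BV_norm_bounds(2)[OF that(1) lohi(1)] by (intro add_left_mono mult_left_mono)
    finally show ?thesis .
  qed
  have "continuous_on {0..T} (?\<Phi> g)" if g: "g \<in> BV" for g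
    unfolding continuous_on_iff
  proof (intro ballI allI impI)
    fix t \<epsilon> :: real assume t: "t \<in> {0..T}" and "\<epsilon> > 0"
    define c where "c = 2 * (BV_norm g + 1)"
    define \<eta> where "\<eta> = \<epsilon> / c"
    have norm: "0 \<le> BV_norm g" using BV_norm_bounds(1)[OF g, of 0] by linarith
    then have "c > 0" by (simp add: c_def)
    then have "\<eta> > 0" using \<open>\<epsilon> > 0\<close> by (simp add: \<eta>_def)
    have "continuous_on {0..T} S" by (rule continuous_on_subset[OF S]) auto
    then obtain d where "d > 0" and d: "\<And>s. s \<in> {0..T} \<Longrightarrow> dist s t < d \<Longrightarrow> dist (S s) (S t) < \<eta>"
      using t \<open>\<eta> > 0\<close> unfolding continuous_on_iff by metis
    have "uniformly_continuous_on ({0..T} \<times> {lo..hi}) (\<lambda>(t, u). L t u)"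
      by (intro compact_uniformly_continuous cont compact_Times compact_Icc)
    then obtain d' where "d' > 0" and d': "\<And>z z'. z \<in> {0..T} \<times> {lo..hi} \<Longrightarrow> z' \<in> {0..T} \<times> {lo..hi} \<Longrightarrow>
        dist z' z < d' \<Longrightarrow> dist (case z' of (t, u) \<Rightarrow> L t u) (case z of (t, u) \<Rightarrow> L t u) < \<eta>"
      using \<open>\<eta> > 0\<close> unfolding uniformly_continuous_on_def by metis
    have "dist (?\<Phi> g s) (?\<Phi> g t) < \<epsilon>" if s: "s \<in> {0..T}" "dist s t < min d d'" for s
    proof -
      have "\<bar>?\<Phi> g s - ?\<Phi> g t\<bar> \<le> BV_norm g * \<bar>S s - S t\<bar> + \<eta> * BV_norm g"
      proof (rule diff[OF g s(1) t])
        fix u assume "u \<in> {lo..hi}"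
        then show "\<bar>L s u - L t u\<bar> \<le> \<eta>"
          using d'[of "(t, u)" "(s, u)"] s t by (auto simp: dist_Pair_Pair dist_real_def)
      qed (use \<open>\<eta> > 0\<close> in simp)
      also have "\<dots> \<le> BV_norm g * \<eta> + \<eta> * BV_norm g"
        using d[of s] s norm by (intro add_right_mono mult_left_mono) (auto simp: dist_real_def)
      also have "\<dots> < \<eta> * c" using \<open>\<eta> > 0\<close> by (simp add: c_def algebra_simps)
      also have "\<dots> = \<epsilon>" using \<open>c > 0\<close> by (simp add: \<eta>_def)
      finally show ?thesis by (simp add: dist_real_def)
    qed
    then show "\<exists>d>0. \<forall>s\<in>{0..T}. dist s t < d \<longrightarrow> dist (?\<Phi> g s) (?\<Phi> g t) < \<epsilon>"
      using \<open>d > 0\<close> \<open>d' > 0\<close> by (intro exI[of _ "min d d'"]) auto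
  qed
  moreover have "?\<Phi> (\<lambda>x. g x + h x) t = ?\<Phi> g t + ?\<Phi> h t" if "g \<in> BV" "h \<in> BV" "t \<in> {0..T}" for g h t
    using tendsto_add[OF conv[OF that(1), of t] conv[OF that(2), of t]] that(3) riemann_sum_add[OF part]
    unfolding pathwise_integral_def by (auto intro!: limI)
  moreover have "?\<Phi> (\<lambda>x. c * g x) t = c * ?\<Phi> g t" if "g \<in> BV" "t \<in> {0..T}" for c g t
    using tendsto_mult_left[OF conv[OF that(1), of t], of c] that(2) riemann_sum_scale[OF part]
    unfolding pathwise_integral_def by (auto intro!: limI)
  moreover have "\<exists>K. \<forall>g\<in>BV. (SUP t\<in>{0..T}. \<bar>?\<Phi> g t\<bar>) \<le> K * BV_norm g"
  proof -
    have "bounded ((\<lambda>(t, u). L t u) ` ({0..T} \<times> {lo..hi}))"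
      by (intro compact_imp_bounded compact_continuous_image cont compact_Times compact_Icc)
    then obtain C where C: "\<And>z. z \<in> {0..T} \<times> {lo..hi} \<Longrightarrow> \<bar>case z of (t, u) \<Rightarrow> L t u\<bar> \<le> C"
      unfolding bounded_iff real_norm_def by blast
    have C: "\<bar>L t u\<bar> \<le> C" if "t \<in> {0..T}" "u \<in> {lo..hi}" for t u
      using C[of "(t, u)"] that by simp
    have "C \<ge> 0" using C[of 0 lo] T lohi(1) by auto
    have L0: "L 0 u = 0" for u
      using tendsto_uniform_limitI[OF lim[OF order_refl], of u]
      by (simp add: partition_sums_at_zero(2)[OF part] LIMSEQ_const_iff)
    have "(SUP t\<in>{0..T}. \<bar>?\<Phi> g t\<bar>) \<le> (hi - lo + C) * BV_norm g" if g: "g \<in> BV" for g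
    proof (rule cSUP_least)
      fix t assume t: "t \<in> {0..T}"
      have norm: "0 \<le> BV_norm g" using BV_norm_bounds(1)[OF g, of 0] by linarith
      have "\<bar>?\<Phi> g t - ?\<Phi> g 0\<bar> \<le> BV_norm g * \<bar>S t - S 0\<bar> + C * BV_norm g"
        using T C t \<open>C \<ge> 0\<close> by (intro diff[OF g t]) (auto simp: L0)
      also have "\<dots> \<le> BV_norm g * (hi - lo) + C * BV_norm g"
      proof (intro add_right_mono mult_left_mono norm)
        have "S t \<in> {lo..hi}" "S 0 \<in> {lo..hi}" using lohi(2) t T by (auto simp: image_subset_iff)
        then show "\<bar>S t - S 0\<bar> \<le> hi - lo" by auto
      qed
      finally show "\<bar>?\<Phi> g t\<bar> \<le> (hi - lo + C) * BV_norm g"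
        by (simp add: pathwise_integral_zero_time[OF part] algebra_simps)
    qed (use T in simp)
    then show ?thesis by blast
  qed
  ultimately show ?thesis unfolding bounded_linear_BV_C_def by blast
qed

theorem theorem2p6:
  fixes \<pi> :: "nat \<Rightarrow> nat \<Rightarrow> ereal"
    and S :: "real \<Rightarrow> real"
    and L :: "real \<Rightarrow> real \<Rightarrow> real"
  assumes "\<And>n. is_partition (\<pi> n)"
    and "is_continuous_local_time \<pi> S L"
  shows "(\<forall>f f'. absolutely_continuous_fun f \<and> has_RN_derivative f f' \<and>
              right_continuous f' \<and> locally_bounded_variation f' \<longrightarrow>
            (\<forall>t\<ge>0. pathwise_integrable \<pi> f' S t \<and> LS_integrable (L t) f' \<and>
               f (S t) = f (S 0) + pathwise_integral \<pi> f' S t + LS_integral (L t) f'))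
       \<and> (\<forall>g. locally_bounded_variation g \<longrightarrow> (\<forall>t\<ge>0. pathwise_integrable \<pi> g S t))
       \<and> (\<forall>T>0. bounded_linear_BV_C T (\<lambda>g. pathwise_integral \<pi> g S))"
proof -
  have S: "continuous_on {0..} S"
    and lim: "\<And>t. 0 \<le> t \<Longrightarrow> uniform_limit UNIV (\<lambda>n. discrete_local_time (\<pi> n) S t) (L t) sequentially"
    and contL: "\<And>t. 0 \<le> t \<Longrightarrow> continuous_on UNIV (L t)"
    and L: "continuous_on ({0..} \<times> UNIV) (\<lambda>(t, u). L t u)"
    using assms(2) by (auto simp: is_continuous_local_time_def paths_with_L2_local_time_def)
  have "pathwise_integrable \<pi> g S t" if "locally_bounded_variation g" "0 \<le> t" for g t
    unfolding pathwise_integrable_def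
    by (rule convergent_riemann_sums[OF assms(1) S that(2) lim[OF that(2)] that(1)])
  moreover have "LS_integrable (L t) f' \<and>
      f (S t) = f (S 0) + pathwise_integral \<pi> f' S t + LS_integral (L t) f'"
    if "has_RN_derivative f f'" "right_continuous f'" "locally_bounded_variation f'" "0 \<le> t" for f f' t
  proof -
    note formula = riemann_sums_tendsto_change_of_variable[OF assms(1) S that(4) lim[OF that(4)]
      contL[OF that(4)] that(3,2,1)]
    show ?thesis
      using formula(1) limI[OF formula(2)] by (simp add: pathwise_integral_def)
  qed
  moreover have "bounded_linear_BV_C T (\<lambda>g. pathwise_integral \<pi> g S)" if "T > 0" for T
    by (rule pathwise_integral_bounded_linear[OF assms(1) S lim L that])
  ultimately show ?thesis by blast
qed

end
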